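(* Let $F:(M^m,g)\to(B^n,g')$ be a Clairaut conformal submersion between Riemannian manifolds with $r=e^f$ and dilation $\lambda$, where $f:M\to\mathbb{R}$ is smooth. Then $F$ is harmonic if and only if $$(m-n)\,\nabla f=(n-2)\,\nabla\log\lambda .$$
   Context: All manifolds, maps and functions are smooth; $\dim M=m$, $\dim B=n$. For a submersion $F:(M,g)\to(B,g')$, the vertical distribution is $\ker F_\ast$ and the horizontal distribution is its $g$-orthogonal complement. $F$ is a conformal submersion with dilation $\lambda:M\to\mathbb{R}^+$ if $g'(F_\ast X,F_\ast Y)=\lambda^2 g(X,Y)$ for all horizontal $X,Y$. A conformal submersion $F$ is a Clairaut conformal submersion with function $r:M\to\mathbb{R}^+$ if for every geodesic $\alpha$ on $(M,g)$ the function $t\mapsto r(\alpha(t))\sin\omega(t)$ is constant, where $\omega(t)\in[0,\pi/2]$ is the angle between $\dot\alpha(t)$ and the horizontal space at $\alpha(t)$. $\nabla f$, $\nabla\log\lambda$ are gradients with respect to $g$. $F$ is harmonic if its tension field $\tau(F)=\mathrm{trace}_g(\nabla F_\ast)$ vanishes identically, where $(\nabla F_\ast)(X,Y)=\nabla^F_X F_\ast Y-F_\ast(\nabla_X Y)$, with $\nabla$ the Levi-Civita connection of $g$ and $\nabla^F$ the pullback to $F^{-1}TB$ of the Levi-Civita connection of $g'$. *)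

theory Defs
  imports "HOL-Analysis.Analysis"
begin

section \<open>Smooth functions on open subsets of Euclidean spaces\<close>

text \<open>The set \<open>S\<close> is always open where this is used; in finite dimension continuity of all
  iterated directional derivatives is continuity of the iterated Frechet derivatives.\<close>

primrec Ck_on :: "nat \<Rightarrow> 'a::euclidean_space set \<Rightarrow> ('a \<Rightarrow> 'b::real_normed_vector) \<Rightarrow> bool" where
  "Ck_on 0 S f \<longleftrightarrow> continuous_on S f"
| "Ck_on (Suc k) S f \<longleftrightarrow>
     (\<forall>x\<in>S. f differentiable (at x)) \<and> (\<forall>v. Ck_on k S (\<lambda>x. frechet_derivative f (at x) v))"

definition smooth_on :: "'a::euclidean_space set \<Rightarrow> ('a \<Rightarrow> 'b::real_normed_vector) \<Rightarrow> bool" where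
  "smooth_on S f \<longleftrightarrow> (\<forall>k. Ck_on k S f)"

section \<open>Riemannian manifolds\<close>

text \<open>A chart is a pair of its domain and its coordinate map; values of the coordinate map outside
  the domain are irrelevant.  Tangent vectors at a point are represented by their components with
  respect to a chart around that point, and tensors by their components in all charts of the atlas
  together with the usual transformation law.  The dimension of the manifold is \<open>DIM('a)\<close>;
  it is at least 1.\<close>

type_synonym ('m, 'a) chart = "'m set \<times> ('m \<Rightarrow> 'a)"

record ('m, 'a) riem_mfd =
  mtop :: "'m topology"
  atlas :: "('m, 'a) chart set"
  metric_tensor :: "('m, 'a) chart \<Rightarrow> 'm \<Rightarrow> 'a \<Rightarrow> 'a \<Rightarrow> real"

abbreviation points :: "('m, 'a) riem_mfd \<Rightarrow> 'm set" where
  "points M \<equiv> topspace (mtop M)"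

definition charts_at :: "('m, 'a) riem_mfd \<Rightarrow> 'm \<Rightarrow> ('m, 'a) chart set" where
  "charts_at M p = {c \<in> atlas M. p \<in> fst c}"

definition chart_inv :: "('m, 'a) chart \<Rightarrow> 'a \<Rightarrow> 'm" where
  "chart_inv c = inv_into (fst c) (snd c)"

definition coord_map :: "('m \<Rightarrow> 'n) \<Rightarrow> ('m, 'a) chart \<Rightarrow> ('n, 'b) chart \<Rightarrow> 'a \<Rightarrow> 'b" where
  "coord_map F c d = snd d \<circ> F \<circ> chart_inv c"

text \<open>The differential \<open>F\<^sub>*\<close> at \<open>p\<close>, in components with respect to \<open>c\<close> around \<open>p\<close> and \<open>d\<close>
  around \<open>F p\<close>.\<close>

definition differential ::
  "('m \<Rightarrow> 'n) \<Rightarrow> ('m, 'a::euclidean_space) chart \<Rightarrow> ('n, 'b::euclidean_space) chart \<Rightarrow> 'm \<Rightarrow> 'a \<Rightarrow> 'b"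
where
  "differential F c d p = frechet_derivative (coord_map F c d) (at (snd c p))"

locale riemannian_manifold =
  fixes M :: "('m, 'a::euclidean_space) riem_mfd"
  assumes Hausdorff: "Hausdorff_space (mtop M)"
    and second_countable: "second_countable (mtop M)"
    and chart_domain: "c \<in> atlas M \<Longrightarrow> openin (mtop M) (fst c)"
    and chart_image: "c \<in> atlas M \<Longrightarrow> open (snd c ` fst c)"
    and chart_homeo: "c \<in> atlas M \<Longrightarrow>
      homeomorphic_map (subtopology (mtop M) (fst c)) (top_of_set (snd c ` fst c)) (snd c)"
    and cover: "(\<Union>c\<in>atlas M. fst c) = points M"
    and transition_smooth: "c \<in> atlas M \<Longrightarrow> d \<in> atlas M \<Longrightarrow>
      smooth_on (snd c ` (fst c \<inter> fst d)) (coord_map id c d)"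
    and metric_bilinear: "c \<in> charts_at M p \<Longrightarrow> bilinear (metric_tensor M c p)"
    and metric_sym: "c \<in> charts_at M p \<Longrightarrow> metric_tensor M c p u v = metric_tensor M c p v u"
    and metric_pos: "c \<in> charts_at M p \<Longrightarrow> u \<noteq> 0 \<Longrightarrow> metric_tensor M c p u u > 0"
    and metric_smooth: "c \<in> atlas M \<Longrightarrow>
      smooth_on (snd c ` fst c) (\<lambda>x. metric_tensor M c (chart_inv c x) u v)"
    and metric_transform: "c \<in> charts_at M p \<Longrightarrow> d \<in> charts_at M p \<Longrightarrow>
      metric_tensor M c p u v =
        metric_tensor M d p (differential id c d p u) (differential id c d p v)"

definition smooth_fun :: "('m, 'a::euclidean_space) riem_mfd \<Rightarrow> ('m \<Rightarrow> real) \<Rightarrow> bool" where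
  "smooth_fun M f \<longleftrightarrow> (\<forall>c\<in>atlas M. smooth_on (snd c ` fst c) (f \<circ> chart_inv c))"

definition smooth_map ::
  "('m, 'a::euclidean_space) riem_mfd \<Rightarrow> ('n, 'b::euclidean_space) riem_mfd \<Rightarrow> ('m \<Rightarrow> 'n) \<Rightarrow> bool"
where
  "smooth_map M B F \<longleftrightarrow>
     continuous_map (mtop M) (mtop B) F \<and>
     (\<forall>c\<in>atlas M. \<forall>d\<in>atlas B.
        smooth_on (snd c ` {p \<in> fst c. F p \<in> fst d}) (coord_map F c d))"

text \<open>\<open>grad M f c p\<close>: the components with respect to \<open>c\<close> of the gradient of \<open>f\<close> at \<open>p\<close>.\<close>

definition grad ::
  "('m, 'a::euclidean_space) riem_mfd \<Rightarrow> ('m \<Rightarrow> real) \<Rightarrow> ('m, 'a) chart \<Rightarrow> 'm \<Rightarrow> 'a"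
where
  "grad M f c p =
     (THE w. \<forall>v. metric_tensor M c p w v = frechet_derivative (f \<circ> chart_inv c) (at (snd c p)) v)"

section \<open>The Levi-Civita connection and geodesics\<close>

text \<open>In a chart, a connection is \<open>\<nabla>\<^sub>X Y = DY(X) + \<Gamma>(X, Y)\<close> with \<open>\<Gamma>\<close> bilinear.  It is torsion-free
  iff \<open>\<Gamma>\<close> is symmetric, and it is metric iff \<open>X (g (Y, Z)) = g (\<nabla>\<^sub>X Y, Z) + g (Y, \<nabla>\<^sub>X Z)\<close> holds for
  the constant coordinate fields; these two conditions determine \<open>\<Gamma>\<close> at each point.\<close>

definition levi_civita ::
  "('m, 'a::euclidean_space) riem_mfd \<Rightarrow> ('m, 'a) chart \<Rightarrow> 'm \<Rightarrow> 'a \<Rightarrow> 'a \<Rightarrow> 'a"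
where
  "levi_civita M c p =
     (THE \<Gamma>. bilinear \<Gamma> \<and> (\<forall>u v. \<Gamma> u v = \<Gamma> v u) \<and>
        (\<forall>u v w. frechet_derivative (\<lambda>x. metric_tensor M c (chart_inv c x) v w) (at (snd c p)) u =
                   metric_tensor M c p (\<Gamma> u v) w + metric_tensor M c p v (\<Gamma> u w)))"

text \<open>Vector fields \<open>X\<close>, \<open>Y\<close> near \<open>p\<close> are given by their components with respect to \<open>c\<close>.\<close>

definition cov_deriv ::
  "('m, 'a::euclidean_space) riem_mfd \<Rightarrow> ('m, 'a) chart \<Rightarrow> ('m \<Rightarrow> 'a) \<Rightarrow> ('m \<Rightarrow> 'a) \<Rightarrow> 'm \<Rightarrow> 'a"
where
  "cov_deriv M c X Y p =
     frechet_derivative (Y \<circ> chart_inv c) (at (snd c p)) (X p) + levi_civita M c p (X p) (Y p)"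

definition velocity :: "('m, 'a::euclidean_space) chart \<Rightarrow> (real \<Rightarrow> 'm) \<Rightarrow> real \<Rightarrow> 'a" where
  "velocity c \<alpha> t = vector_derivative (snd c \<circ> \<alpha>) (at t)"

definition geodesic ::
  "('m, 'a::euclidean_space) riem_mfd \<Rightarrow> real set \<Rightarrow> (real \<Rightarrow> 'm) \<Rightarrow> bool"
where
  "geodesic M J \<alpha> \<longleftrightarrow>
     open J \<and> is_interval J \<and> continuous_map (top_of_set J) (mtop M) \<alpha> \<and>
     (\<forall>c\<in>atlas M. smooth_on {t \<in> J. \<alpha> t \<in> fst c} (snd c \<circ> \<alpha>)) \<and>
     (\<forall>t\<in>J. \<forall>c\<in>charts_at M (\<alpha> t).
        vector_derivative (velocity c \<alpha>) (at t)
          + levi_civita M c (\<alpha> t) (velocity c \<alpha> t) (velocity c \<alpha> t) = 0)"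

section \<open>Harmonic maps\<close>

text \<open>The pullback connection on sections \<open>V\<close> of \<open>F\<^sup>-\<^sup>1 TB\<close>; the components of \<open>X\<close> and \<open>V\<close> are taken
  with respect to the charts \<open>c\<close> of \<open>M\<close> and \<open>d\<close> of \<open>B\<close>.\<close>

definition pullback_cov_deriv ::
  "('n, 'b::euclidean_space) riem_mfd \<Rightarrow> ('m \<Rightarrow> 'n) \<Rightarrow> ('m, 'a::euclidean_space) chart \<Rightarrow>
   ('n, 'b) chart \<Rightarrow> ('m \<Rightarrow> 'a) \<Rightarrow> ('m \<Rightarrow> 'b) \<Rightarrow> 'm \<Rightarrow> 'b"
where
  "pullback_cov_deriv B F c d X V p =
     frechet_derivative (V \<circ> chart_inv c) (at (snd c p)) (X p)
       + levi_civita B d (F p) (differential F c d p (X p)) (V p)"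

definition second_fundamental_form ::
  "('m, 'a::euclidean_space) riem_mfd \<Rightarrow> ('n, 'b::euclidean_space) riem_mfd \<Rightarrow> ('m \<Rightarrow> 'n) \<Rightarrow>
   ('m, 'a) chart \<Rightarrow> ('n, 'b) chart \<Rightarrow> ('m \<Rightarrow> 'a) \<Rightarrow> ('m \<Rightarrow> 'a) \<Rightarrow> 'm \<Rightarrow> 'b"
where
  "second_fundamental_form M B F c d X Y p =
     pullback_cov_deriv B F c d X (\<lambda>q. differential F c d q (Y q)) p
       - differential F c d p (cov_deriv M c X Y p)"

definition orthonormal_basis :: "('a::real_vector \<Rightarrow> 'a \<Rightarrow> real) \<Rightarrow> 'a set \<Rightarrow> bool" where
  "orthonormal_basis G E \<longleftrightarrow>
     span E = UNIV \<and> (\<forall>u\<in>E. \<forall>v\<in>E. G u v = (if u = v then 1 else 0))"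

text \<open>The trace is independent of the chosen orthonormal basis, and since the second fundamental
  form is tensorial, the basis may be extended by constant components in the chart.\<close>

definition tension_field ::
  "('m, 'a::euclidean_space) riem_mfd \<Rightarrow> ('n, 'b::euclidean_space) riem_mfd \<Rightarrow> ('m \<Rightarrow> 'n) \<Rightarrow>
   ('m, 'a) chart \<Rightarrow> ('n, 'b) chart \<Rightarrow> 'm \<Rightarrow> 'b"
where
  "tension_field M B F c d p =
     (\<Sum>e\<in>(SOME E. orthonormal_basis (metric_tensor M c p) E).
        second_fundamental_form M B F c d (\<lambda>_. e) (\<lambda>_. e) p)"

definition harmonic_map ::
  "('m, 'a::euclidean_space) riem_mfd \<Rightarrow> ('n, 'b::euclidean_space) riem_mfd \<Rightarrow> ('m \<Rightarrow> 'n) \<Rightarrow> bool"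
where
  "harmonic_map M B F \<longleftrightarrow>
     (\<forall>p\<in>points M. \<forall>c\<in>charts_at M p. \<forall>d\<in>charts_at B (F p). tension_field M B F c d p = 0)"

section \<open>Clairaut conformal submersions\<close>

definition vertical ::
  "('n, 'b::euclidean_space) riem_mfd \<Rightarrow> ('m \<Rightarrow> 'n) \<Rightarrow> ('m, 'a::euclidean_space) chart \<Rightarrow> 'm \<Rightarrow> 'a set"
where
  "vertical B F c p = {v. \<forall>d\<in>charts_at B (F p). differential F c d p v = 0}"

definition horizontal ::
  "('m, 'a::euclidean_space) riem_mfd \<Rightarrow> ('n, 'b::euclidean_space) riem_mfd \<Rightarrow> ('m \<Rightarrow> 'n) \<Rightarrow>
   ('m, 'a) chart \<Rightarrow> 'm \<Rightarrow> 'a set"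
where
  "horizontal M B F c p = {u. \<forall>v\<in>vertical B F c p. metric_tensor M c p u v = 0}"

definition submersion ::
  "('m, 'a::euclidean_space) riem_mfd \<Rightarrow> ('n, 'b::euclidean_space) riem_mfd \<Rightarrow> ('m \<Rightarrow> 'n) \<Rightarrow> bool"
where
  "submersion M B F \<longleftrightarrow>
     smooth_map M B F \<and>
     (\<forall>p\<in>points M. \<forall>c\<in>charts_at M p. \<forall>d\<in>charts_at B (F p). surj (differential F c d p))"

definition conformal_submersion ::
  "('m, 'a::euclidean_space) riem_mfd \<Rightarrow> ('n, 'b::euclidean_space) riem_mfd \<Rightarrow> ('m \<Rightarrow> 'n) \<Rightarrow>
   ('m \<Rightarrow> real) \<Rightarrow> bool"
where
  "conformal_submersion M B F lam \<longleftrightarrow>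
     submersion M B F \<and> smooth_fun M lam \<and> (\<forall>p\<in>points M. lam p > 0) \<and>
     (\<forall>p\<in>points M. \<forall>c\<in>charts_at M p. \<forall>d\<in>charts_at B (F p).
        \<forall>X\<in>horizontal M B F c p. \<forall>Y\<in>horizontal M B F c p.
          metric_tensor B d (F p) (differential F c d p X) (differential F c d p Y)
            = (lam p)\<^sup>2 * metric_tensor M c p X Y)"

definition orth_proj :: "('a::real_vector \<Rightarrow> 'a \<Rightarrow> real) \<Rightarrow> 'a set \<Rightarrow> 'a \<Rightarrow> 'a" where
  "orth_proj G S v = (THE h. h \<in> S \<and> (\<forall>s\<in>S. G (v - h) s = 0))"

text \<open>The angle in \<open>[0, \<pi>/2]\<close> between a vector and a subspace.  For \<open>v = 0\<close> the value is \<open>\<pi>/2\<close>;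
  this only concerns constant geodesics, on which the Clairaut condition below holds trivially.\<close>

definition angle_to :: "('a::real_vector \<Rightarrow> 'a \<Rightarrow> real) \<Rightarrow> 'a set \<Rightarrow> 'a \<Rightarrow> real" where
  "angle_to G S v = arccos (sqrt (G (orth_proj G S v) (orth_proj G S v)) / sqrt (G v v))"

definition clairaut_conformal_submersion ::
  "('m, 'a::euclidean_space) riem_mfd \<Rightarrow> ('n, 'b::euclidean_space) riem_mfd \<Rightarrow> ('m \<Rightarrow> 'n) \<Rightarrow>
   ('m \<Rightarrow> real) \<Rightarrow> ('m \<Rightarrow> real) \<Rightarrow> bool"
where
  "clairaut_conformal_submersion M B F lam r \<longleftrightarrow>
     conformal_submersion M B F lam \<and> smooth_fun M r \<and> (\<forall>p\<in>points M. r p > 0) \<and>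
     (\<forall>J \<alpha>. geodesic M J \<alpha> \<longrightarrow>
        (\<exists>k. \<forall>t\<in>J. \<forall>c\<in>charts_at M (\<alpha> t).
           r (\<alpha> t) * sin (angle_to (metric_tensor M c (\<alpha> t)) (horizontal M B F c (\<alpha> t))
                             (velocity c \<alpha> t)) = k))"

end

theory Submission
  imports Defs
begin

text \<open>
  Let \<open>S = \<nabla>F\<^sub>*\<close> and split a tangent vector as \<open>v = h + u\<close> with \<open>h\<close> horizontal and \<open>u\<close> vertical.
  Since \<open>r\<^sup>2 |u|\<^sup>2 / |v|\<^sup>2\<close> is constant along the geodesic with initial velocity \<open>v\<close>, its derivative at the
  starting point vanishes, which is the identity
  \<open>\<lambda>\<^sup>2 df(v) |u|\<^sup>2 + \<lambda>\<^sup>2 (d log \<lambda>)(v) |h|\<^sup>2 = g'(S(v, v), F\<^sub>* v)\<close>, cubic in \<open>v\<close>.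
  Its components with respect to the degree in \<open>u\<close> say that \<open>df\<close> vanishes on vertical vectors,
  that \<open>g'(S(u, u), F\<^sub>* h) = \<lambda>\<^sup>2 df(h) |u|\<^sup>2\<close>, and that
  \<open>2 g'(S(u, h), F\<^sub>* h) = \<lambda>\<^sup>2 (d log \<lambda>)(u) |h|\<^sup>2\<close>.  Every conformal submersion satisfies
  \<open>g'(S(z, h), F\<^sub>* h) = \<lambda>\<^sup>2 (d log \<lambda>)(z) |h|\<^sup>2\<close> for all \<open>z\<close>, so that \<open>d log \<lambda>\<close> vanishes on vertical
  vectors as well; polarizing this identity and using the symmetry of \<open>S\<close> gives
  \<open>g'(S(h, h), F\<^sub>* k) = 2 \<lambda>\<^sup>2 (d log \<lambda>)(h) g(h, k) - \<lambda>\<^sup>2 (d log \<lambda>)(k) |h|\<^sup>2\<close> for horizontal \<open>h\<close>, \<open>k\<close>.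
  Taking traces, \<open>g'(\<tau>(F), F\<^sub>* k) = \<lambda>\<^sup>2 ((m - n) df(k) - (n - 2) (d log \<lambda>)(k))\<close>.
\<close>

section \<open>Calculus of smooth functions on open sets\<close>

text \<open>The Clairaut condition constrains geodesics, so it says something about a tangent vector
  only once a geodesic with that initial velocity exists. This is why a local existence theorem for
  differential equations underlies the argument. A short solution in one chart suffices, as the
  derivative is taken at time 0, but it has to satisfy the geodesic equation in every chart of the
  atlas; chart transitions are isometries, and the vanishing of their second fundamental form
  settles this.

  Differentiating the angle directly would require horizontal projections that vary smoothly with
  the point. Instead the vertical part is measured by lambda^2 |v|^2 - |F_* v|^2 = lambda^2 |u|^2,
  an expression in the two metrics and the dilation. It is nonnegative on all vectors and zero
  exactly on horizontal ones, so an extremum argument on it also yields the identity valid for every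
  conformal submersion, without extending a horizontal vector to a horizontal field.\<close>

lemma frechet_derivative_cong_open:
  assumes "open S" "x \<in> S" "\<And>y. y \<in> S \<Longrightarrow> f y = g y"
  shows "frechet_derivative f (at x) = frechet_derivative g (at x)"
proof -
  \<comment> \<open>\<open>frechet_derivative\<close> is a choice among all derivatives, so it is
    enough that both functions have the same derivatives, also at points where there are
    none.\<close>
  have "(f has_derivative D) (at x) \<longleftrightarrow> (g has_derivative D) (at x)" for D
    using has_derivative_transform_within_open[OF _ assms(1,2), of f D UNIV g]
      has_derivative_transform_within_open[OF _ assms(1,2), of g D UNIV f] assms(3) by auto
  then show ?thesis by (simp add: frechet_derivative_def)
qed

lemma differentiable_cong_open:
  assumes "open S" "x \<in> S" "\<And>y. y \<in> S \<Longrightarrow> f y = g y" "f differentiable (at x)"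
  shows "g differentiable (at x)"
  using assms has_derivative_transform_within_open[OF _ assms(1,2), of f _ UNIV g]
  by (metis differentiable_def)

lemma Ck_on_cong:
  assumes "open S" "\<And>x. x \<in> S \<Longrightarrow> f x = g x"
  shows "Ck_on k S f \<Longrightarrow> Ck_on k S g"
  using assms(2)
proof (induction k arbitrary: f g)
  case 0
  then show ?case using continuous_on_cong by fastforce
next
  case (Suc k)
  have "Ck_on k S (\<lambda>x. frechet_derivative g (at x) v)" for v
    using Suc.IH[of "\<lambda>x. frechet_derivative f (at x) v" "\<lambda>x. frechet_derivative g (at x) v"] Suc.prems
      frechet_derivative_cong_open[OF assms(1), of _ f g] by auto
  moreover have "g differentiable (at x)" if "x \<in> S" for x
    using differentiable_cong_open[OF assms(1) that, of f g] Suc.prems that by auto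
  ultimately show ?case by simp
qed

lemma Ck_on_subset: "Ck_on k S f \<Longrightarrow> T \<subseteq> S \<Longrightarrow> Ck_on k T f"
  by (induction k arbitrary: f) (auto intro: continuous_on_subset)

lemma Ck_on_Suc_D: "Ck_on (Suc k) S f \<Longrightarrow> Ck_on k S f"
proof (induction k arbitrary: f)
  case 0
  then show ?case
    by (auto intro!: continuous_at_imp_continuous_on differentiable_imp_continuous_within)
next
  case (Suc k)
  then show ?case by (meson Ck_on.simps(2))
qed

lemma Ck_on_const [simp]: "Ck_on k S (\<lambda>x. c)"
  by (induction k arbitrary: c) auto

lemma Ck_on_linear:
  assumes "bounded_linear L"
  shows "Ck_on k S f \<Longrightarrow> open S \<Longrightarrow> Ck_on k S (\<lambda>x. L (f x))"
proof (induction k arbitrary: f)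
  case 0
  then show ?case using assms bounded_linear.continuous_on by auto
next
  case (Suc k)
  have D: "((\<lambda>x. L (f x)) has_derivative (\<lambda>v. L (frechet_derivative f (at x) v))) (at x)"
    if "x \<in> S" for x
    using bounded_linear.has_derivative[OF assms] Suc.prems that
    by (auto simp: frechet_derivative_works)
  have "Ck_on k S (\<lambda>x. frechet_derivative (\<lambda>x. L (f x)) (at x) v)" for v
    by (rule Ck_on_cong[of _ "\<lambda>x. L (frechet_derivative f (at x) v)"])
      (use Suc frechet_derivative_at[OF D] in \<open>auto simp: fun_eq_iff\<close>)
  then show ?case using D by (auto simp: differentiable_def)
qed

lemma Ck_on_ident: "open S \<Longrightarrow> Ck_on k S (\<lambda>x. x)"
  by (cases k) auto

lemma Ck_on_add:
  "Ck_on k S f \<Longrightarrow> Ck_on k S g \<Longrightarrow> open S \<Longrightarrow> Ck_on k S (\<lambda>x. f x + g x)"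
proof (induction k arbitrary: f g)
  case 0
  then show ?case by (auto intro: continuous_intros)
next
  case (Suc k)
  have D: "((\<lambda>x. f x + g x) has_derivative
     (\<lambda>v. frechet_derivative f (at x) v + frechet_derivative g (at x) v)) (at x)" if "x \<in> S" for x
    using Suc.prems that by (auto simp: frechet_derivative_works intro!: has_derivative_add)
  have "Ck_on k S (\<lambda>x. frechet_derivative (\<lambda>x. f x + g x) (at x) v)" for v
    by (rule Ck_on_cong[of _ "\<lambda>x. frechet_derivative f (at x) v + frechet_derivative g (at x) v"])
      (use Suc frechet_derivative_at[OF D] in \<open>auto simp: fun_eq_iff\<close>)
  then show ?case using D by (auto simp: differentiable_def)
qed

lemma Ck_on_sum:
  "finite I \<Longrightarrow> open S \<Longrightarrow> (\<And>i. i \<in> I \<Longrightarrow> Ck_on k S (f i)) \<Longrightarrow> Ck_on k S (\<lambda>x. \<Sum>i\<in>I. f i x)"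
  by (induction I rule: finite_induct) (auto intro!: Ck_on_add)

lemma Ck_on_scaleR:
  "Ck_on k S f \<Longrightarrow> Ck_on k S g \<Longrightarrow> open S \<Longrightarrow> Ck_on k S (\<lambda>x. f x *\<^sub>R g x)"
proof (induction k arbitrary: f g)
  case 0
  then show ?case by (auto intro: continuous_intros)
next
  case (Suc k)
  have D: "((\<lambda>x. f x *\<^sub>R g x) has_derivative
     (\<lambda>v. f x *\<^sub>R frechet_derivative g (at x) v + frechet_derivative f (at x) v *\<^sub>R g x)) (at x)"
    if "x \<in> S" for x
    using Suc.prems that by (auto simp: frechet_derivative_works intro!: has_derivative_scaleR)
  have "Ck_on k S (\<lambda>x. frechet_derivative (\<lambda>x. f x *\<^sub>R g x) (at x) v)" for v
    by (rule Ck_on_cong[of _ "\<lambda>x. f x *\<^sub>R frechet_derivative g (at x) v + frechet_derivative f (at x) v *\<^sub>R g x"])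
      (use Suc frechet_derivative_at[OF D] Ck_on_Suc_D[OF Suc.prems(1)] Ck_on_Suc_D[OF Suc.prems(2)]
        in \<open>auto simp: fun_eq_iff intro!: Ck_on_add\<close>)
  then show ?case using D by (auto simp: differentiable_def)
qed

text \<open>The derivative is -(1/h) Dh (1/h), so order k + 1 reduces to order k for 1/h itself,
  which the induction supplies.\<close>

lemma Ck_on_inverse:
  fixes h :: "'a::euclidean_space \<Rightarrow> real"
  assumes "open S" "\<And>x. x \<in> S \<Longrightarrow> h x \<noteq> 0"
  shows "Ck_on k S h \<Longrightarrow> Ck_on k S (\<lambda>x. inverse (h x))"
proof (induction k)
  case 0
  then show ?case using assms by (auto intro!: continuous_intros)
next
  case (Suc k)
  have D: "((\<lambda>x. inverse (h x)) has_derivative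
     (\<lambda>v. - (inverse (h x) * frechet_derivative h (at x) v * inverse (h x)))) (at x)"
    if "x \<in> S" for x
    using Suc.prems that assms(2) by (auto simp: frechet_derivative_works intro!: has_derivative_inverse)
  have I: "Ck_on k S (\<lambda>x. inverse (h x))"
    using Suc Ck_on_Suc_D by blast
  have "Ck_on k S (\<lambda>x. frechet_derivative h (at x) v)" for v
    using Suc.prems by simp
  then have "Ck_on k S (\<lambda>x. inverse (h x) *\<^sub>R frechet_derivative h (at x) v)" for v
    by (rule Ck_on_scaleR[OF I _ assms(1)])
  then have "Ck_on k S (\<lambda>x. (inverse (h x) *\<^sub>R frechet_derivative h (at x) v) *\<^sub>R inverse (h x))" for v
    by (rule Ck_on_scaleR[OF _ I assms(1)])
  then have *: "Ck_on k S (\<lambda>x. - ((inverse (h x) *\<^sub>R frechet_derivative h (at x) v) *\<^sub>R inverse (h x)))" for v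
    using assms(1) bounded_linear_minus[OF bounded_linear_ident] Ck_on_linear[of uminus] by auto
  have "Ck_on k S (\<lambda>x. frechet_derivative (\<lambda>x. inverse (h x)) (at x) v)" for v
    by (rule Ck_on_cong[OF assms(1) _ *[of v]])
      (use frechet_derivative_at[OF D] in \<open>auto simp: fun_eq_iff\<close>)
  then show ?case using D by (auto simp: differentiable_def)
qed

lemma linear_euclidean_expand:
  fixes f :: "'a::euclidean_space \<Rightarrow> 'b::real_vector"
  assumes "linear f"
  shows "f x = (\<Sum>b\<in>Basis. (x \<bullet> b) *\<^sub>R f b)"
proof -
  have "f x = f (\<Sum>b\<in>Basis. (x \<bullet> b) *\<^sub>R b)" by (simp add: euclidean_representation)
  also have "\<dots> = (\<Sum>b\<in>Basis. (x \<bullet> b) *\<^sub>R f b)"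
    using assms by (simp add: linear_sum linear_scale)
  finally show ?thesis .
qed

lemma bilinear_euclidean_expand:
  fixes G :: "'a::euclidean_space \<Rightarrow> 'b::euclidean_space \<Rightarrow> 'c::real_vector"
  assumes "bilinear G"
  shows "G u v = (\<Sum>i\<in>Basis. \<Sum>j\<in>Basis. (u \<bullet> i) *\<^sub>R (v \<bullet> j) *\<^sub>R G i j)"
proof -
  have "G u v = (\<Sum>i\<in>Basis. (u \<bullet> i) *\<^sub>R G i v)"
    using assms by (intro linear_euclidean_expand[of "\<lambda>u. G u v"]) (simp add: bilinear_def)
  also have "\<dots> = (\<Sum>i\<in>Basis. (u \<bullet> i) *\<^sub>R (\<Sum>j\<in>Basis. (v \<bullet> j) *\<^sub>R G i j))"
    using assms by (intro sum.cong refl arg_cong2[where f=scaleR] linear_euclidean_expand) (simp_all add: bilinear_def)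
  finally show ?thesis by (simp add: scaleR_sum_right)
qed

text \<open>The chain rule yields the derivative of \<open>g\<close> at \<open>h x\<close> in a
  direction that varies with \<open>x\<close>. Expanding this direction in the standard basis leaves
  derivatives of \<open>g\<close> in fixed directions, to which the induction hypothesis applies;
  hence the generalization over \<open>g\<close>.\<close>

lemma Ck_on_compose:
  fixes h :: "'a::euclidean_space \<Rightarrow> 'b::euclidean_space"
  assumes "open S" "open T" "h ` S \<subseteq> T"
  shows "Ck_on k S h \<Longrightarrow> Ck_on k T g \<Longrightarrow> Ck_on k S (\<lambda>x. g (h x))"
proof (induction k arbitrary: g)
  case 0
  then show ?case using assms by (auto intro: continuous_on_compose2)
next
  case (Suc k)
  have D: "((\<lambda>x. g (h x)) has_derivative
     (\<lambda>v. frechet_derivative g (at (h x)) (frechet_derivative h (at x) v))) (at x)"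
    if "x \<in> S" for x
    using Suc.prems that assms(3)
    by (intro has_derivative_compose[of h _ x UNIV g]) (auto simp: frechet_derivative_works)
  have *: "Ck_on k S (\<lambda>x. \<Sum>b\<in>Basis. (frechet_derivative h (at x) v \<bullet> b) *\<^sub>R frechet_derivative g (at (h x)) b)" for v
    using assms(1) Suc.prems Ck_on_Suc_D[OF Suc.prems(1)]
    by (intro Ck_on_sum Ck_on_scaleR Suc.IH Ck_on_linear[OF bounded_linear_inner_left]) auto
  have "Ck_on k S (\<lambda>x. frechet_derivative (\<lambda>x. g (h x)) (at x) v)" for v
  proof (rule Ck_on_cong[OF assms(1) _ *[of v]])
    fix x assume x: "x \<in> S"
    then have "linear (frechet_derivative g (at (h x)))"
      using Suc.prems assms(3) by (intro linear_frechet_derivative) auto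
    then show "(\<Sum>b\<in>Basis. (frechet_derivative h (at x) v \<bullet> b) *\<^sub>R frechet_derivative g (at (h x)) b) =
         frechet_derivative (\<lambda>x. g (h x)) (at x) v"
      using frechet_derivative_at[OF D[OF x]] linear_euclidean_expand by metis
  qed
  then show ?case using D by (auto simp: differentiable_def)
qed

lemma smooth_on_differentiable: "smooth_on S f \<Longrightarrow> x \<in> S \<Longrightarrow> f differentiable (at x)"
  unfolding smooth_on_def by (drule spec[of _ "Suc 0"]) simp

lemma smooth_on_has_derivative: "smooth_on S f \<Longrightarrow> x \<in> S \<Longrightarrow>
    (f has_derivative frechet_derivative f (at x)) (at x)"
  using smooth_on_differentiable frechet_derivative_works by blast

lemma smooth_on_derivative: "smooth_on S f \<Longrightarrow> smooth_on S (\<lambda>x. frechet_derivative f (at x) v)"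
  unfolding smooth_on_def proof
  fix k assume "\<forall>k. Ck_on k S f"
  then have "Ck_on (Suc k) S f" by blast
  then show "Ck_on k S (\<lambda>x. frechet_derivative f (at x) v)" by simp
qed

lemma smooth_on_continuous: "smooth_on S f \<Longrightarrow> continuous_on S f"
  unfolding smooth_on_def by (drule spec[of _ 0]) simp

lemma smooth_on_subset: "smooth_on S f \<Longrightarrow> T \<subseteq> S \<Longrightarrow> smooth_on T f"
  unfolding smooth_on_def using Ck_on_subset by blast

lemma smooth_on_cong: "open S \<Longrightarrow> (\<And>x. x \<in> S \<Longrightarrow> f x = g x) \<Longrightarrow> smooth_on S f \<Longrightarrow> smooth_on S g"
  unfolding smooth_on_def using Ck_on_cong by blast

lemma smooth_on_linear: "bounded_linear L \<Longrightarrow> smooth_on S f \<Longrightarrow> open S \<Longrightarrow> smooth_on S (\<lambda>x. L (f x))"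
  unfolding smooth_on_def using Ck_on_linear by blast

lemma smooth_on_const [simp]: "smooth_on S (\<lambda>x. c)"
  unfolding smooth_on_def by auto

lemma smooth_on_ident: "open S \<Longrightarrow> smooth_on S (\<lambda>x. x)"
  unfolding smooth_on_def using Ck_on_ident by auto

lemma smooth_on_add: "smooth_on S f \<Longrightarrow> smooth_on S g \<Longrightarrow> open S \<Longrightarrow> smooth_on S (\<lambda>x. f x + g x)"
  unfolding smooth_on_def using Ck_on_add by blast

lemma smooth_on_minus: "smooth_on S f \<Longrightarrow> open S \<Longrightarrow> smooth_on S (\<lambda>x. - f x)"
  using smooth_on_linear[OF bounded_linear_minus[OF bounded_linear_ident]] .

lemma smooth_on_diff: "smooth_on S f \<Longrightarrow> smooth_on S g \<Longrightarrow> open S \<Longrightarrow> smooth_on S (\<lambda>x. f x - g x)"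
  using smooth_on_add[OF _ smooth_on_minus, of S f g] by simp

lemma smooth_on_sum:
  "finite I \<Longrightarrow> open S \<Longrightarrow> (\<And>i. i \<in> I \<Longrightarrow> smooth_on S (f i)) \<Longrightarrow> smooth_on S (\<lambda>x. \<Sum>i\<in>I. f i x)"
  unfolding smooth_on_def using Ck_on_sum by blast

lemma smooth_on_scaleR:
  "smooth_on S f \<Longrightarrow> smooth_on S g \<Longrightarrow> open S \<Longrightarrow> smooth_on S (\<lambda>x. f x *\<^sub>R g x)"
  unfolding smooth_on_def using Ck_on_scaleR by blast

lemma smooth_on_inverse:
  fixes h :: "'a::euclidean_space \<Rightarrow> real"
  shows "open S \<Longrightarrow> (\<And>x. x \<in> S \<Longrightarrow> h x \<noteq> 0) \<Longrightarrow> smooth_on S h \<Longrightarrow> smooth_on S (\<lambda>x. inverse (h x))"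
  unfolding smooth_on_def using Ck_on_inverse by blast

lemma smooth_on_compose:
  fixes h :: "'a::euclidean_space \<Rightarrow> 'b::euclidean_space"
  assumes "open S" "open T" "h ` S \<subseteq> T" "smooth_on S h" "smooth_on T g"
  shows "smooth_on S (\<lambda>x. g (h x))"
  using assms Ck_on_compose unfolding smooth_on_def by blast

lemma smooth_on_bilinear:
  fixes G :: "'x::euclidean_space \<Rightarrow> 'a::euclidean_space \<Rightarrow> 'b::euclidean_space \<Rightarrow> 'c::real_normed_vector"
  assumes "open S" "\<And>x. x \<in> S \<Longrightarrow> bilinear (G x)" "\<And>i j. smooth_on S (\<lambda>x. G x i j)"
    "smooth_on S u" "smooth_on S v"
  shows "smooth_on S (\<lambda>x. G x (u x) (v x))"
proof (rule smooth_on_cong[OF assms(1)])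
  show "smooth_on S (\<lambda>x. \<Sum>i\<in>Basis. \<Sum>j\<in>Basis. (u x \<bullet> i) *\<^sub>R (v x \<bullet> j) *\<^sub>R G x i j)"
    using assms by (intro smooth_on_sum smooth_on_scaleR smooth_on_linear[OF bounded_linear_inner_left]) auto
qed (rule bilinear_euclidean_expand[OF assms(2), symmetric])

text \<open>Basis expansion turns the value into a finite sum of products of three real functions.
  After regrouping, the first of the three terms moves the base point with both arguments frozen at
  time \<open>t\<close>.\<close>

lemma bilinear_along_curve_derivative:
  fixes G :: "'x::euclidean_space \<Rightarrow> 'a::euclidean_space \<Rightarrow> 'b::euclidean_space \<Rightarrow> real"
  assumes "open S" "\<And>x. x \<in> S \<Longrightarrow> bilinear (G x)" "\<And>i j. smooth_on S (\<lambda>x. G x i j)"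
    and x: "(x has_vector_derivative x') (at t)" and xS: "x t \<in> S"
    and a: "(a has_vector_derivative a') (at t)" and b: "(b has_vector_derivative b') (at t)"
  shows "((\<lambda>t. G (x t) (a t) (b t)) has_real_derivative
     (frechet_derivative (\<lambda>y. G y (a t) (b t)) (at (x t)) x' + G (x t) a' (b t) + G (x t) (a t) b')) (at t)"
proof -
  let ?D = "\<lambda>i j. frechet_derivative (\<lambda>y. G y i j) (at (x t))"
  have Gd: "((\<lambda>t. G (x t) i j) has_real_derivative ?D i j x') (at t)" for i j
    using vector_derivative_diff_chain_within[of x x' t UNIV "\<lambda>y. G y i j"]
      x has_derivative_at_withinI[OF smooth_on_has_derivative[OF assms(3) xS]]
    by (simp add: has_real_derivative_iff_has_vector_derivative o_def)
  have ad: "((\<lambda>t. a t \<bullet> i) has_real_derivative a' \<bullet> i) (at t)" for i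
    using bounded_linear.has_vector_derivative[OF bounded_linear_inner_left a]
    by (simp add: has_real_derivative_iff_has_vector_derivative)
  have bd: "((\<lambda>t. b t \<bullet> i) has_real_derivative b' \<bullet> i) (at t)" for i
    using bounded_linear.has_vector_derivative[OF bounded_linear_inner_left b]
    by (simp add: has_real_derivative_iff_has_vector_derivative)
  have 1: "((\<lambda>t. \<Sum>i\<in>Basis. \<Sum>j\<in>Basis. (a t \<bullet> i) * ((b t \<bullet> j) * G (x t) i j)) has_real_derivative
    (\<Sum>i\<in>Basis. \<Sum>j\<in>Basis. (a t \<bullet> i) * ((b t \<bullet> j) * ?D i j x')
       + (a' \<bullet> i) * ((b t \<bullet> j) * G (x t) i j) + (a t \<bullet> i) * ((b' \<bullet> j) * G (x t) i j))) (at t)"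
    by (intro DERIV_sum) (auto intro!: derivative_eq_intros Gd ad bd simp: algebra_simps)
  have D: "((\<lambda>y. \<Sum>i\<in>Basis. \<Sum>j\<in>Basis. (a t \<bullet> i) * ((b t \<bullet> j) * G y i j)) has_derivative
      (\<lambda>v. \<Sum>i\<in>Basis. \<Sum>j\<in>Basis. (a t \<bullet> i) * ((b t \<bullet> j) * ?D i j v))) (at (x t))"
    by (intro has_derivative_sum has_derivative_mult_right smooth_on_has_derivative[OF assms(3) xS])
  have E: "G y u v = (\<Sum>i\<in>Basis. \<Sum>j\<in>Basis. (u \<bullet> i) * ((v \<bullet> j) * G y i j))" if "y \<in> S" for y u v
    using bilinear_euclidean_expand[OF assms(2)[OF that], of u v] by simp
  have "frechet_derivative (\<lambda>y. G y (a t) (b t)) (at (x t)) =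
     frechet_derivative (\<lambda>y. \<Sum>i\<in>Basis. \<Sum>j\<in>Basis. (a t \<bullet> i) * ((b t \<bullet> j) * G y i j)) (at (x t))"
    by (rule frechet_derivative_cong_open[OF assms(1) xS E])
  also have "\<dots> = (\<lambda>v. \<Sum>i\<in>Basis. \<Sum>j\<in>Basis. (a t \<bullet> i) * ((b t \<bullet> j) * ?D i j v))"
    using frechet_derivative_at[OF D] by simp
  finally have F: "frechet_derivative (\<lambda>y. G y (a t) (b t)) (at (x t)) x' =
      (\<Sum>i\<in>Basis. \<Sum>j\<in>Basis. (a t \<bullet> i) * ((b t \<bullet> j) * ?D i j x'))" by simp
  have "isCont x t" using x has_vector_derivative_continuous by blast
  then have "\<forall>\<^sub>F s in nhds t. x s \<in> S"
    using assms(1) xS by (auto simp: eventually_nhds_conv_at isCont_def dest: topological_tendstoD)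
  then have ev: "\<forall>\<^sub>F s in nhds t. (\<Sum>i\<in>Basis. \<Sum>j\<in>Basis. (a s \<bullet> i) * ((b s \<bullet> j) * G (x s) i j)) = G (x s) (a s) (b s)"
    by eventually_elim (rule E[symmetric])
  show ?thesis
    unfolding F E[OF xS, of a' "b t"] E[OF xS, of "a t" b']
    using iffD1[OF DERIV_cong_ev[OF refl ev refl] 1] by (simp only: sum.distrib)
qed

text \<open>The second difference over the parallelogram spanned by s u and s v does not see the
  order of u and v. Applying the mean value theorem twice, in either order, turns it into s^2 times
  a mixed derivative at a nearby point, and continuity of the mixed derivatives gives equality at
  \<open>x\<close>.\<close>

lemma second_derivative_symmetric_real:
  fixes f :: "'a::euclidean_space \<Rightarrow> real"
  assumes "open S" "smooth_on S f" "x \<in> S"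
  shows "frechet_derivative (\<lambda>y. frechet_derivative f (at y) u) (at x) v
       = frechet_derivative (\<lambda>y. frechet_derivative f (at y) v) (at x) u"
proof -
  define D where "D u = (\<lambda>y. frechet_derivative f (at y) u)" for u
  define E where "E u v = (\<lambda>y. frechet_derivative (D u) (at y) v)" for u v
  obtain e where e: "e > 0" "ball x e \<subseteq> S" using assms openE by blast
  \<comment> \<open>The summand 1 keeps the denominator positive when u = v = 0; for coefficients
    below \<open>s0\<close> the parallelogram stays inside the ball of radius
    \<open>e\<close>.\<close>
  define s0 where "s0 = e / (norm u + norm v + 1)"
  have n1: "norm u + norm v + 1 > 0" by (simp add: add_nonneg_pos)
  have s0: "s0 > 0" using e n1 by (simp add: s0_def)
  have inS: "x + a *\<^sub>R u + b *\<^sub>R v \<in> S" if "0 \<le> a" "0 \<le> b" "a < s0" "b < s0" for a b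
  proof -
    have "norm (a *\<^sub>R u + b *\<^sub>R v) \<le> a * norm u + b * norm v"
      using norm_triangle_ineq[of "a *\<^sub>R u" "b *\<^sub>R v"] that by simp
    also have "\<dots> \<le> s0 * norm u + s0 * norm v"
      using that by (intro add_mono mult_right_mono) auto
    also have "\<dots> < s0 * (norm u + norm v + 1)" using s0 by (simp add: algebra_simps)
    also have "\<dots> = e" using n1 by (simp add: s0_def)
    finally have "dist (x + a *\<^sub>R u + b *\<^sub>R v) x < e" by (simp add: dist_norm add.assoc)
    then show ?thesis using e by (auto simp: dist_commute)
  qed
  have line: "((\<lambda>r. h (p + r *\<^sub>R w)) has_real_derivative frechet_derivative h (at (p + r *\<^sub>R w)) w) (at r)"
    if "smooth_on S h" "p + r *\<^sub>R w \<in> S" for h :: "'a \<Rightarrow> real" and p w r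
  proof -
    have "((\<lambda>r. p + r *\<^sub>R w) has_vector_derivative w) (at r)"
      by (auto intro!: derivative_eq_intros)
    then show ?thesis
      using vector_derivative_diff_chain_within[of "\<lambda>r. p + r *\<^sub>R w" w r UNIV h]
      has_derivative_at_withinI[OF smooth_on_has_derivative[OF that]]
      by (simp add: has_real_derivative_iff_has_vector_derivative o_def)
  qed
  have smD: "smooth_on S (D u)" for u unfolding D_def by (rule smooth_on_derivative[OF assms(2)])
  have smE: "smooth_on S (E u v)" for u v unfolding E_def by (rule smooth_on_derivative[OF smD])
  let ?Q = "\<lambda>s. f (x + s *\<^sub>R u + s *\<^sub>R v) - f (x + s *\<^sub>R u) - f (x + s *\<^sub>R v) + f x"
  have key: "\<exists>a b. 0 < a \<and> a < s \<and> 0 < b \<and> b < s \<and>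
      f (x + s *\<^sub>R p + s *\<^sub>R q) - f (x + s *\<^sub>R p) - f (x + s *\<^sub>R q) + f x = s * s * E p q (x + a *\<^sub>R p + b *\<^sub>R q)"
    if s: "0 < s" "s < s0" and pq: "(p = u \<and> q = v) \<or> (p = v \<and> q = u)" for s p q
  proof -
    have inS': "x + a *\<^sub>R p + b *\<^sub>R q \<in> S" if "0 \<le> a" "0 \<le> b" "a < s0" "b < s0" for a b
      using pq inS[OF that] inS[of b a] that by (auto simp: algebra_simps)
    have d1: "((\<lambda>r. f ((x + s *\<^sub>R q) + r *\<^sub>R p) - f (x + r *\<^sub>R p)) has_real_derivative
       D p ((x + s *\<^sub>R q) + r *\<^sub>R p) - D p (x + r *\<^sub>R p)) (at r)" if "0 \<le> r" "r \<le> s" for r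
      unfolding D_def
      using that s inS'[of r s] inS'[of r 0]
      by (intro derivative_intros line assms) (auto simp: algebra_simps)
    obtain a where a: "0 < a" "a < s"
      "f ((x + s *\<^sub>R q) + s *\<^sub>R p) - f (x + s *\<^sub>R p) - (f ((x + s *\<^sub>R q) + 0 *\<^sub>R p) - f (x + 0 *\<^sub>R p))
        = (s - 0) * (D p ((x + s *\<^sub>R q) + a *\<^sub>R p) - D p (x + a *\<^sub>R p))"
      using MVT2[OF s(1), of "\<lambda>r. f ((x + s *\<^sub>R q) + r *\<^sub>R p) - f (x + r *\<^sub>R p)"
         "\<lambda>r. D p ((x + s *\<^sub>R q) + r *\<^sub>R p) - D p (x + r *\<^sub>R p)"] d1 by blast
    have d2: "((\<lambda>r. D p ((x + a *\<^sub>R p) + r *\<^sub>R q)) has_real_derivative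
        E p q ((x + a *\<^sub>R p) + r *\<^sub>R q)) (at r)" if "0 \<le> r" "r \<le> s" for r
      unfolding E_def using that s a inS'[of a r] by (intro line smD) auto
    obtain b where b: "0 < b" "b < s"
      "D p ((x + a *\<^sub>R p) + s *\<^sub>R q) - D p ((x + a *\<^sub>R p) + 0 *\<^sub>R q) = (s - 0) * E p q ((x + a *\<^sub>R p) + b *\<^sub>R q)"
      using MVT2[OF s(1), of "\<lambda>r. D p ((x + a *\<^sub>R p) + r *\<^sub>R q)" "\<lambda>r. E p q ((x + a *\<^sub>R p) + r *\<^sub>R q)"] d2 by blast
    have "f (x + s *\<^sub>R p + s *\<^sub>R q) - f (x + s *\<^sub>R p) - f (x + s *\<^sub>R q) + f x = s * s * E p q (x + a *\<^sub>R p + b *\<^sub>R q)"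
      using a(3) b(3) by (simp add: algebra_simps)
    then show ?thesis using a b by blast
  qed
  have "E u v x = E v u x"
  proof (rule ccontr)
    assume ne: "E u v x \<noteq> E v u x"
    \<comment> \<open>Half the gap: values closer than \<open>d\<close> to \<open>E u v x\<close>
      and to \<open>E v u x\<close> respectively cannot coincide.\<close>
    define d where "d = \<bar>E u v x - E v u x\<bar> / 2"
    have d: "d > 0" using ne by (simp add: d_def)
    have near: "\<exists>e>0. \<forall>y. dist y x < e \<longrightarrow> \<bar>E p q y - E p q x\<bar> < d" for p q
    proof -
      have "isCont (E p q) x"
        using smooth_on_continuous[OF smE] assms by (simp add: continuous_on_eq_continuous_at)
      then show ?thesis using d unfolding continuous_at_eps_delta dist_real_def by blast
    qed
    obtain e1 where e1: "e1 > 0" "\<And>y. dist y x < e1 \<Longrightarrow> \<bar>E u v y - E u v x\<bar> < d" using near by blast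
    obtain e2 where e2: "e2 > 0" "\<And>y. dist y x < e2 \<Longrightarrow> \<bar>E v u y - E v u x\<bar> < d" using near by blast
    define s where "s = min (s0/2) (min e1 e2 / (norm u + norm v + 1))"
    have "s \<le> s0/2" "s \<le> min e1 e2 / (norm u + norm v + 1)" unfolding s_def by (rule min.cobounded1 min.cobounded2)+
    then have sl: "s * (norm u + norm v + 1) \<le> min e1 e2" and "s < s0"
      using s0 pos_le_divide_eq[OF n1] by auto
    have "0 < s" unfolding s_def using s0 e1 e2 n1 by (simp add: min_def divide_pos_pos)
    note s = this \<open>s < s0\<close>
    have close: "dist (x + a *\<^sub>R p + b *\<^sub>R q) x < min e1 e2"
      if "0 < a" "a < s" "0 < b" "b < s" "(p = u \<and> q = v) \<or> (p = v \<and> q = u)" for a b p q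
    proof -
      have "norm (a *\<^sub>R p + b *\<^sub>R q) \<le> a * norm p + b * norm q"
        using norm_triangle_ineq[of "a *\<^sub>R p" "b *\<^sub>R q"] that by simp
      also have "\<dots> \<le> s * norm p + s * norm q"
        using that by (intro add_mono mult_right_mono) auto
      also have "\<dots> = s * (norm u + norm v)" using that(5) by (auto simp: algebra_simps)
      also have "\<dots> < s * (norm u + norm v + 1)" using s by (simp add: algebra_simps)
      finally show ?thesis using sl by (simp add: dist_norm add.assoc)
    qed
    obtain a b where ab: "0 < a" "a < s" "0 < b" "b < s" "?Q s = s * s * E u v (x + a *\<^sub>R u + b *\<^sub>R v)"
      using key[OF s, of u v] by blast
    obtain a' b' where ab': "0 < a'" "a' < s" "0 < b'" "b' < s"
      "f (x + s *\<^sub>R v + s *\<^sub>R u) - f (x + s *\<^sub>R v) - f (x + s *\<^sub>R u) + f x = s * s * E v u (x + a' *\<^sub>R v + b' *\<^sub>R u)"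
      using key[OF s, of v u] by blast
    have "f (x + s *\<^sub>R v + s *\<^sub>R u) - f (x + s *\<^sub>R v) - f (x + s *\<^sub>R u) + f x = ?Q s" by (simp add: add_ac)
    then have "E u v (x + a *\<^sub>R u + b *\<^sub>R v) = E v u (x + a' *\<^sub>R v + b' *\<^sub>R u)"
      using ab(5) ab'(5) s by simp
    moreover have "\<bar>E u v (x + a *\<^sub>R u + b *\<^sub>R v) - E u v x\<bar> < d" using close[of a b u v] ab e1 by auto
    moreover have "\<bar>E v u (x + a' *\<^sub>R v + b' *\<^sub>R u) - E v u x\<bar> < d" using close[of a' b' v u] ab' e2 by auto
    ultimately show False unfolding d_def by (simp add: abs_if field_simps split: if_splits)
  qed
  then show ?thesis by (simp add: E_def D_def)
qed

lemma second_derivative_symmetric: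
  fixes f :: "'a::euclidean_space \<Rightarrow> 'b::euclidean_space"
  assumes "open S" "smooth_on S f" "x \<in> S"
  shows "frechet_derivative (\<lambda>y. frechet_derivative f (at y) u) (at x) v
       = frechet_derivative (\<lambda>y. frechet_derivative f (at y) v) (at x) u"
proof (rule euclidean_eqI)
  fix b :: 'b assume "b \<in> Basis"
  have 1: "frechet_derivative (\<lambda>y. h y \<bullet> b) (at z) w = frechet_derivative h (at z) w \<bullet> b"
    if "smooth_on S h" "z \<in> S" for h :: "'a \<Rightarrow> 'b" and z w
    using frechet_derivative_at[OF bounded_linear.has_derivative[OF bounded_linear_inner_left
      smooth_on_has_derivative[OF that]]] by metis
  have 2: "frechet_derivative (\<lambda>y. frechet_derivative f (at y) u) (at x) v \<bullet> b =
     frechet_derivative (\<lambda>y. frechet_derivative (\<lambda>y. f y \<bullet> b) (at y) u) (at x) v" for u v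
  proof -
    have "frechet_derivative (\<lambda>y. frechet_derivative f (at y) u) (at x) v \<bullet> b =
      frechet_derivative (\<lambda>y. frechet_derivative f (at y) u \<bullet> b) (at x) v"
      using 1[OF smooth_on_derivative[OF assms(2)] assms(3)] by simp
    also have "\<dots> = frechet_derivative (\<lambda>y. frechet_derivative (\<lambda>y. f y \<bullet> b) (at y) u) (at x) v"
      using frechet_derivative_cong_open[OF assms(1,3), of "\<lambda>y. frechet_derivative f (at y) u \<bullet> b"] 1[OF assms(2)] by metis
    finally show ?thesis .
  qed
  show "frechet_derivative (\<lambda>y. frechet_derivative f (at y) u) (at x) v \<bullet> b
       = frechet_derivative (\<lambda>y. frechet_derivative f (at y) v) (at x) u \<bullet> b"
    unfolding 2
    by (intro second_derivative_symmetric_real[OF assms(1) _ assms(3)]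
       smooth_on_linear[OF bounded_linear_inner_left] assms)
qed

section \<open>Inner products on Euclidean spaces\<close>

text \<open>A metric at a point is an arbitrary inner product on the coordinate space, in general
  different from the standard one, so orthogonality and orthonormal bases are developed relative to
  \<open>g\<close>.\<close>

locale inner_form =
  fixes g :: "'a::euclidean_space \<Rightarrow> 'a \<Rightarrow> real"
  assumes bil: "bilinear g"
    and sym: "g u v = g v u"
    and pos: "u \<noteq> 0 \<Longrightarrow> g u u > 0"
begin

lemmas simps = bilinear_ladd[OF bil] bilinear_radd[OF bil] bilinear_lmul[OF bil] bilinear_rmul[OF bil]
  bilinear_lsub[OF bil] bilinear_rsub[OF bil] bilinear_lzero[OF bil] bilinear_rzero[OF bil]
  bilinear_lneg[OF bil] bilinear_rneg[OF bil]

lemma linear_left: "linear (\<lambda>u. g u v)" and linear_right: "linear (g u)"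
  using bil by (auto simp: bilinear_def)

lemma sum_left: "g (\<Sum>i\<in>I. f i) v = (\<Sum>i\<in>I. g (f i) v)"
  using linear_sum[OF linear_left] .

lemma sum_right: "g v (\<Sum>i\<in>I. f i) = (\<Sum>i\<in>I. g v (f i))"
  using linear_sum[OF linear_right] .

lemma nonneg: "g u u \<ge> 0"
  by (cases "u = 0") (use pos in \<open>auto simp: simps less_imp_le\<close>)

lemma eq_0_iff: "g u u = 0 \<longleftrightarrow> u = 0"
  by (cases "u = 0") (use pos[of u] in \<open>auto simp: simps\<close>)

lemma nondegenerate: "(\<And>w. g u w = g v w) \<Longrightarrow> u = v"
  using eq_0_iff[of "u - v"] by (simp add: simps)

definition orthonormal :: "'a set \<Rightarrow> bool" where
  "orthonormal E \<longleftrightarrow> (\<forall>u\<in>E. \<forall>v\<in>E. g u v = (if u = v then 1 else 0))"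

lemma orthonormal_expansion:
  assumes "finite E" "orthonormal E" "v \<in> span E"
  shows "v = (\<Sum>e\<in>E. g v e *\<^sub>R e)"
  using assms(3)
proof (induction rule: span_induct_alt)
  case base
  then show ?case by (simp add: simps)
next
  case (step c x y)
  have "(\<Sum>e\<in>E. g x e *\<^sub>R e) = (\<Sum>e\<in>E. if e = x then x else 0)"
    using assms(2) step(1) unfolding orthonormal_def by (intro sum.cong) auto
  then have "(\<Sum>e\<in>E. g x e *\<^sub>R e) = x"
    using assms(1) step(1) by simp
  then show ?case
    using step(2) by (simp add: simps scaleR_add_left sum.distrib flip: scaleR_scaleR scaleR_sum_right)
qed

lemma orthonormal_independent:
  assumes "orthonormal E"
  shows "independent E"
proof
  assume "dependent E"
  then obtain t u v where t: "finite t" "t \<subseteq> E" "(\<Sum>v\<in>t. u v *\<^sub>R v) = 0" "v \<in> t" "u v \<noteq> 0"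
    unfolding dependent_explicit by blast
  have "0 = g (\<Sum>w\<in>t. u w *\<^sub>R w) v" by (simp add: t simps)
  also have "\<dots> = (\<Sum>w\<in>t. u w * g w v)" by (simp add: sum_left simps)
  also have "\<dots> = (\<Sum>w\<in>t. if w = v then u v else 0)"
    using assms t unfolding orthonormal_def by (intro sum.cong) (auto simp: subset_iff)
  also have "\<dots> = u v" using t by simp
  finally show False using t by simp
qed

lemma orthonormal_finite: "orthonormal E \<Longrightarrow> finite E"
  using orthonormal_independent independent_imp_finite by blast

text \<open>Gram-Schmidt for \<open>g\<close>: the new vector \<open>b\<close> loses its projection
  \<open>p\<close> onto the span already treated, and the remainder, nonzero because
  \<open>b\<close> lies outside that span, is normalized.\<close>

lemma orthonormal_span_of_independent:
  assumes "finite B" "independent B"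
  shows "\<exists>E. orthonormal E \<and> span E = span B"
  using assms
proof (induction B rule: finite_induct)
  case empty
  then show ?case by (intro exI[of _ "{}"]) (auto simp: orthonormal_def)
next
  case (insert b B)
  then obtain E where E: "orthonormal E" "span E = span B"
    using independent_mono[of "insert b B" B] by auto
  have fin: "finite E" using E orthonormal_finite by blast
  have b: "b \<notin> span B" using insert.prems insert.hyps by (auto simp: independent_insert)
  define p where "p = (\<Sum>e\<in>E. g b e *\<^sub>R e)"
  define e where "e = b - p"
  have p: "p \<in> span E" unfolding p_def by (auto intro: span_sum span_scale span_base)
  have e0: "e \<noteq> 0" using b p E unfolding e_def by auto
  have orth: "g e f = 0" if "f \<in> E" for f
  proof -
    have "g p f = (\<Sum>x\<in>E. if x = f then g b f else 0)"
      using E(1) that unfolding p_def orthonormal_def by (auto simp: sum_left simps intro!: sum.cong)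
    then have "g p f = g b f" using fin that by simp
    then show ?thesis by (simp add: e_def simps)
  qed
  define c where "c = 1 / sqrt (g e e)"
  have c: "c > 0" "c * (c * g e e) = 1"
    using pos[OF e0] by (simp_all add: c_def real_div_sqrt)
  have "orthonormal (insert (c *\<^sub>R e) E)"
  proof -
    have "g f e = 0" if "f \<in> E" for f using orth[OF that] by (simp only: sym[of f e])
    \<comment> \<open>Otherwise \<open>orth\<close> would make \<open>e\<close> orthogonal to a
      positive multiple of itself.\<close>
    moreover have "c *\<^sub>R e \<notin> E" using orth[of "c *\<^sub>R e"] c(1) e0 eq_0_iff[of e] by (auto simp: simps)
    ultimately show ?thesis
      using E(1) orth c(2) unfolding orthonormal_def by (auto simp: bilinear_lmul[OF bil] bilinear_rmul[OF bil])
  qed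
  moreover have "span (insert (c *\<^sub>R e) E) = span (insert b B)"
  proof -
    have "span (insert (c *\<^sub>R e) E) = span (insert b E)"
    proof (rule span_eq[THEN iffD2], intro conjI subsetI)
      fix x assume "x \<in> insert (c *\<^sub>R e) E"
      moreover have "e \<in> span (insert b E)" unfolding e_def
        by (rule span_diff[OF span_base]) (use p span_mono[of E "insert b E"] in blast)+
      ultimately show "x \<in> span (insert b E)" by (auto intro: span_scale span_base)
    next
      fix x assume "x \<in> insert b E"
      moreover have "b \<in> span (insert (c *\<^sub>R e) E)"
      proof -
        have "(1 / c) *\<^sub>R (c *\<^sub>R e) + p \<in> span (insert (c *\<^sub>R e) E)"
          by (intro span_add span_scale[OF span_base])
            (use p span_mono[of E "insert (c *\<^sub>R e) E"] in blast)+
        then show ?thesis using c(1) by (simp add: e_def)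
      qed
      ultimately show "x \<in> span (insert (c *\<^sub>R e) E)" by (auto intro: span_base)
    qed
    also have "\<dots> = span (insert b B)" using E(2) by (simp add: span_insert)
    finally show ?thesis .
  qed
  ultimately show ?case by blast
qed

lemma orthonormal_basis_of_subspace:
  assumes "subspace V"
  obtains E where "orthonormal E" "finite E" "span E = V" "card E = dim V"
proof -
  obtain B where B: "B \<subseteq> V" "independent B" "V \<subseteq> span B" using basis_exists by metis
  obtain E where E: "orthonormal E" "span E = span B"
    using orthonormal_span_of_independent[OF independent_imp_finite[OF B(2)] B(2)] by blast
  have V: "span E = V" using E(2) B assms by (metis span_eq_iff span_mono subset_antisym)
  have "card E = dim V" using V orthonormal_independent[OF E(1)] by (metis dim_span dim_eq_card_independent)
  then show thesis using that E(1) V orthonormal_finite by blast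
qed

definition ortho_compl :: "'a set \<Rightarrow> 'a set" where
  "ortho_compl V = {u. \<forall>v\<in>V. g u v = 0}"

lemma subspace_ortho_compl: "subspace (ortho_compl V)"
  by (auto simp: ortho_compl_def subspace_def simps)

lemma ortho_decomposition:
  assumes "subspace V"
  obtains h v where "h \<in> ortho_compl V" "v \<in> V" "w = h + v"
proof -
  obtain E where E: "orthonormal E" "finite E" "span E = V"
    using orthonormal_basis_of_subspace[OF assms] by blast
  define v where "v = (\<Sum>e\<in>E. g w e *\<^sub>R e)"
  have v: "v \<in> V" unfolding v_def using E(3) by (auto intro: span_sum span_scale span_base)
  have 1: "g v f = g w f" if "f \<in> E" for f
  proof -
    have "g v f = (\<Sum>x\<in>E. if x = f then g w f else 0)"
      using E(1) that unfolding v_def orthonormal_def by (auto simp: sum_left simps intro!: sum.cong)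
    then show ?thesis using E that by simp
  qed
  have "g (w - v) u = 0" if "u \<in> V" for u
  proof -
    have "u = (\<Sum>e\<in>E. g u e *\<^sub>R e)" using orthonormal_expansion E that by blast
    then have "g (w - v) u = (\<Sum>e\<in>E. g u e * g (w - v) e)"
      using sum_right[of "w - v" "\<lambda>e. g u e *\<^sub>R e" E] by (simp only: bilinear_rmul[OF bil] real_scaleR_def)
    also have "\<dots> = 0" using 1 by (simp add: simps)
    finally show ?thesis .
  qed
  then have "w - v \<in> ortho_compl V" by (simp add: ortho_compl_def)
  then show thesis using that[of "w - v" v] v by simp
qed

text \<open>Expanding each member of \<open>E\<close> in \<open>E'\<close> and exchanging the sums
  leaves as coefficients the sums over e of g f e * g f' e, which equal g f f' by expanding f in
  \<open>E\<close>. This allows the arbitrarily chosen basis in \<open>tension_field\<close> to be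
  replaced by one fitted to the map.\<close>

lemma trace_independent:
  assumes T: "bilinear T" and E: "orthonormal E" "span E = UNIV" and E': "orthonormal E'" "span E' = UNIV"
  shows "(\<Sum>e\<in>E. T e e) = (\<Sum>f\<in>E'. (T f f :: real))"
proof -
  have fin: "finite E" "finite E'" using E E' orthonormal_finite by auto
  have Tl: "linear (\<lambda>u. T u v)" and Tr: "linear (T u)" for u v using T by (auto simp: bilinear_def)
  have ex: "T e e = (\<Sum>f\<in>E'. \<Sum>f'\<in>E'. g f e * g f' e * T f f')" for e
  proof -
    have e: "e = (\<Sum>f\<in>E'. g e f *\<^sub>R f)" using orthonormal_expansion[OF fin(2) E'(1)] E'(2) by blast
    have "T e e = T (\<Sum>f\<in>E'. g e f *\<^sub>R f) (\<Sum>f'\<in>E'. g e f' *\<^sub>R f')" using e by simp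
    also have "\<dots> = (\<Sum>f\<in>E'. T (g e f *\<^sub>R f) (\<Sum>f'\<in>E'. g e f' *\<^sub>R f'))"
      by (rule linear_sum[OF Tl])
    also have "\<dots> = (\<Sum>f\<in>E'. \<Sum>f'\<in>E'. g e f * (g e f' * T f f'))"
      by (simp add: linear_sum[OF Tr] linear_scale[OF Tl] linear_scale[OF Tr] sum_distrib_left mult.left_commute)
    finally show ?thesis by (simp add: sym[of e] mult.assoc)
  qed
  have "(\<Sum>e\<in>E. T e e) = (\<Sum>f\<in>E'. \<Sum>f'\<in>E'. (\<Sum>e\<in>E. g f e * g f' e) * T f f')"
    by (simp add: ex sum_distrib_right sum.swap[of _ E' E])
  also have "\<dots> = (\<Sum>f\<in>E'. \<Sum>f'\<in>E'. g f f' * T f f')"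
  proof (intro sum.cong refl)
    fix f f' show "(\<Sum>e\<in>E. g f e * g f' e) * T f f' = g f f' * T f f'"
    proof -
      have "f = (\<Sum>e\<in>E. g f e *\<^sub>R e)" using orthonormal_expansion[OF fin(1) E(1)] E(2) by blast
      then have "g f f' = g (\<Sum>e\<in>E. g f e *\<^sub>R e) f'" by simp
      also have "\<dots> = (\<Sum>e\<in>E. g f e * g f' e)" by (simp add: sum_left simps sym[of f'])
      finally show ?thesis by simp
    qed
  qed
  also have "\<dots> = (\<Sum>f\<in>E'. \<Sum>f'\<in>E'. if f' = f then T f f else 0)"
    using E'(1) unfolding orthonormal_def by (intro sum.cong) auto
  also have "\<dots> = (\<Sum>f\<in>E'. T f f)" using fin by simp
  finally show ?thesis .
qed

text \<open>With V the vertical space, a trace over such a basis splits into a horizontal and a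
  vertical sum, and the cardinalities become the numbers of terms n and m - n.\<close>

lemma adapted_orthonormal_basis:
  assumes "subspace V"
  obtains E E' where "orthonormal E" "orthonormal E'" "E \<subseteq> ortho_compl V" "E' \<subseteq> V"
    "E \<inter> E' = {}" "orthonormal (E \<union> E')" "span (E \<union> E') = UNIV" "card E = dim (ortho_compl V)" "card E + card E' = DIM('a)"
proof -
  obtain E where E: "orthonormal E" "finite E" "span E = ortho_compl V" "card E = dim (ortho_compl V)"
    using orthonormal_basis_of_subspace[OF subspace_ortho_compl] by metis
  obtain E' where E': "orthonormal E'" "finite E'" "span E' = V"
    using orthonormal_basis_of_subspace[OF assms] by metis
  have 1: "E \<subseteq> ortho_compl V" "E' \<subseteq> V" using E E' span_base by blast+
  have 2: "E \<inter> E' = {}"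
  proof (rule ccontr)
    assume "E \<inter> E' \<noteq> {}"
    then obtain e where "e \<in> E" "e \<in> E'" by blast
    moreover from this have "g e e = 1" using E(1) unfolding orthonormal_def by simp
    ultimately have "g e e = 0" using 1 unfolding ortho_compl_def by blast
    with \<open>g e e = 1\<close> show False by simp
  qed
  have 3: "orthonormal (E \<union> E')"
  proof -
    have z: "g u v = 0" "g v u = 0" "u \<noteq> v" if "u \<in> E" "v \<in> E'" for u v
    proof -
      show "g u v = 0" using that 1 unfolding ortho_compl_def by blast
      then show "g v u = 0" by (simp add: sym)
      show "u \<noteq> v" using that 2 by blast
    qed
    show ?thesis
      unfolding orthonormal_def
    proof (intro ballI)
      fix u v assume "u \<in> E \<union> E'" "v \<in> E \<union> E'"
      then show "g u v = (if u = v then 1 else 0)"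
        using E(1) E'(1) z[of u v] z[of v u] unfolding orthonormal_def by (elim UnE) simp_all
    qed
  qed
  have 4: "span (E \<union> E') = UNIV"
  proof (intro equalityI subsetI UNIV_I)
    fix w :: 'a
    obtain h v where "h \<in> ortho_compl V" "v \<in> V" "w = h + v" using ortho_decomposition[OF assms] .
    then show "w \<in> span (E \<union> E')" using E E' span_mono[of E "E \<union> E'"] span_mono[of E' "E \<union> E'"]
      by (auto intro!: span_add)
  qed
  have "card (E \<union> E') = DIM('a)"
    using orthonormal_independent[OF 3] 4 by (metis dim_UNIV dim_eq_card_independent dim_span)
  then have "card E + card E' = DIM('a)" using card_Un_disjoint[OF E(2) E'(2) 2] by simp
  then show thesis using that E E' 1 2 3 4 by blast
qed

end

section \<open>Metrics in coordinates and their Christoffel symbols\<close>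

text \<open>The condition under the description operator in \<open>levi_civita\<close>, stated at a
  point of the coordinate space so that it can be studied without a manifold.\<close>

definition is_christoffel :: "('a::euclidean_space \<Rightarrow> 'a \<Rightarrow> 'a \<Rightarrow> real) \<Rightarrow> 'a \<Rightarrow> ('a \<Rightarrow> 'a \<Rightarrow> 'a) \<Rightarrow> bool" where
  "is_christoffel G x \<Gamma> \<longleftrightarrow> bilinear \<Gamma> \<and> (\<forall>u v. \<Gamma> u v = \<Gamma> v u) \<and>
     (\<forall>u v w. frechet_derivative (\<lambda>y. G y v w) (at x) u = G x (\<Gamma> u v) w + G x v (\<Gamma> u w))"

locale coordinate_metric =
  fixes S :: "'a::euclidean_space set" and G :: "'a \<Rightarrow> 'a \<Rightarrow> 'a \<Rightarrow> real"
  assumes open_S: "open S"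
    and form: "x \<in> S \<Longrightarrow> inner_form (G x)"
    and smooth: "smooth_on S (\<lambda>x. G x u v)"
begin

lemma bilinear_G: "x \<in> S \<Longrightarrow> bilinear (G x)"
  using form inner_form.bil by blast

lemma smooth_comb: "smooth_on S u \<Longrightarrow> smooth_on S v \<Longrightarrow> smooth_on S (\<lambda>x. G x (u x) (v x))"
  by (rule smooth_on_bilinear[OF open_S bilinear_G smooth])

text \<open>Gram-Schmidt, one basis vector at a time, keeps the solution smooth.\<close>

lemma smooth_solution_on_subbasis:
  assumes "finite I" "I \<subseteq> Basis" "\<And>b. b \<in> I \<Longrightarrow> smooth_on S (l b)"
  shows "\<exists>w. smooth_on S w \<and> (\<forall>x\<in>S. w x \<in> span I \<and> (\<forall>b\<in>I. G x (w x) b = l b x))"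
  using assms
proof (induction I arbitrary: l rule: finite_induct)
  case empty
  then show ?case by (intro exI[of _ "\<lambda>_. 0"]) auto
next
  case (insert b I)
  \<comment> \<open>With right-hand sides \<open>G x b c\<close> the induction hypothesis produces
    the \<open>G x\<close>-orthogonal projection of \<open>b\<close> onto the span of
    \<open>I\<close>, smooth in \<open>x\<close>.\<close>
  obtain n where n: "smooth_on S n" "\<And>x. x \<in> S \<Longrightarrow> n x \<in> span I"
     "\<And>x c. x \<in> S \<Longrightarrow> c \<in> I \<Longrightarrow> G x (n x) c = G x b c"
    using insert.IH[of "\<lambda>c x. G x b c"] insert.prems smooth by auto
  obtain w where w: "smooth_on S w" "\<And>x. x \<in> S \<Longrightarrow> w x \<in> span I"
     "\<And>x c. x \<in> S \<Longrightarrow> c \<in> I \<Longrightarrow> G x (w x) c = l c x"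
    using insert.IH[of l] insert.prems by auto
  define e where "e x = b - n x" for x
  have sm_e: "smooth_on S e" unfolding e_def by (intro smooth_on_diff n open_S smooth_on_const)
  have b: "b \<notin> span I"
  proof -
    have "independent (insert b I)" using insert.prems independent_Basis independent_mono by blast
    then show ?thesis using insert.hyps by (simp add: independent_insert)
  qed
  have e0: "G x (e x) (e x) \<noteq> 0" if "x \<in> S" for x
    using b n(2)[OF that] inner_form.eq_0_iff[OF form[OF that]] unfolding e_def by auto
  have e_orth: "G x (e x) c = 0" if "x \<in> S" "c \<in> span I" for x c
    using that(2)
  proof (induction rule: span_induct_alt)
    case base
    then show ?case by (simp add: bilinear_rzero[OF bilinear_G[OF that(1)]])
  next
    case (step a c y)
    then show ?case using n(3)[OF that(1) step(1)]
      by (simp add: e_def inner_form.simps[OF form[OF that(1)]])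
  qed
  \<comment> \<open>Since the product of \<open>e x\<close> with \<open>b\<close> equals that with
    \<open>e x\<close> itself, this coefficient gives \<open>W x\<close> the required product with
    \<open>b\<close>; orthogonality of \<open>e x\<close> to \<open>I\<close> preserves the earlier
    equations.\<close>
  define q where "q x = (l b x - G x (w x) b) * inverse (G x (e x) (e x))" for x
  define W where "W x = w x + q x *\<^sub>R e x" for x
  have "smooth_on S (\<lambda>x. (l b x - G x (w x) b) *\<^sub>R inverse (G x (e x) (e x)))"
    using insert.prems e0
    by (intro smooth_on_scaleR smooth_on_inverse smooth_on_diff smooth_comb w sm_e open_S smooth_on_const) auto
  then have "smooth_on S q" by (simp add: q_def[abs_def])
  then have "smooth_on S W" unfolding W_def by (intro smooth_on_add smooth_on_scaleR w sm_e open_S)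
  moreover have "W x \<in> span (insert b I)" if "x \<in> S" for x
    unfolding W_def e_def using w(2)[OF that] n(2)[OF that] span_mono[of I "insert b I"]
    by (intro span_add span_scale span_diff) (auto intro: span_base)
  moreover have "G x (W x) c = l c x" if "x \<in> S" "c \<in> insert b I" for x c
  proof -
    interpret inner_form "G x" using form that by blast
    have "G x (e x) (e x) = G x (e x) b - G x (e x) (n x)" by (simp add: e_def simps)
    then have eb: "G x (e x) b = G x (e x) (e x)" using e_orth[OF that(1) n(2)[OF that(1)]] by simp
    show ?thesis
    proof (cases "c = b")
      case True
      have "G x (W x) b = G x (w x) b + q x * G x (e x) (e x)"
        by (simp add: W_def simps eb)
      also have "\<dots> = l b x" using e0[OF that(1)] by (simp add: q_def mult.assoc)
      finally show ?thesis using True by simp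
    next
      case False
      then have "c \<in> I" using that by simp
      then show ?thesis using w(3)[OF that(1)] e_orth[OF that(1)] span_base[of c I] by (simp add: W_def simps)
    qed
  qed
  ultimately show ?case by (intro exI[of _ W]) auto
qed

text \<open>Riesz representation with smooth dependence on the point; it turns the Koszul expression
  into smooth Christoffel symbols.\<close>

lemma smooth_solution:
  assumes "\<And>b. smooth_on S (\<lambda>x. l x b)" "\<And>x. x \<in> S \<Longrightarrow> linear (l x)"
  shows "\<exists>w. smooth_on S w \<and> (\<forall>x\<in>S. \<forall>v. G x (w x) v = l x v)"
proof -
  obtain w where w: "smooth_on S w" "\<And>x b. x \<in> S \<Longrightarrow> b \<in> Basis \<Longrightarrow> G x (w x) b = l x b"
    using smooth_solution_on_subbasis[OF finite_Basis order.refl, of "\<lambda>b x. l x b"] assms by auto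
  have "G x (w x) v = l x v" if "x \<in> S" for x v
    by (rule linear_eq_stdbasis[THEN fun_cong, where f = "G x (w x)"])
      (use w(2) assms(2) that inner_form.linear_right[OF form] in auto)
  then show ?thesis using w by blast
qed

definition dG :: "'a \<Rightarrow> 'a \<Rightarrow> 'a \<Rightarrow> 'a \<Rightarrow> real" where
  "dG x u v w = frechet_derivative (\<lambda>y. G y v w) (at x) u"

lemma has_derivative_G: "x \<in> S \<Longrightarrow> ((\<lambda>y. G y v w) has_derivative (\<lambda>u. dG x u v w)) (at x)"
  unfolding dG_def by (rule smooth_on_has_derivative[OF smooth])

lemma dG_unique:
  assumes "x \<in> S" "(f has_derivative f') (at x)" "\<And>y. y \<in> S \<Longrightarrow> f y = G y v w"
  shows "dG x u v w = f' u"
  using frechet_derivative_cong_open[OF open_S assms(1), of f "\<lambda>y. G y v w"] assms(3)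
    frechet_derivative_at[OF assms(2)] unfolding dG_def by simp

lemma dG_linear:
  assumes "x \<in> S"
  shows "linear (\<lambda>u. dG x u v w)" "linear (\<lambda>v. dG x u v w)" "linear (\<lambda>w. dG x u v w)"
    "dG x u v w = dG x u w v"
proof -
  show "linear (\<lambda>u. dG x u v w)"
    using has_derivative_G[OF assms] has_derivative_linear by blast
  note d = has_derivative_G[OF assms]
  show "linear (\<lambda>v. dG x u v w)"
  proof (rule linearI)
    show "dG x u (v + v') w = dG x u v w + dG x u v' w" for v v'
      by (rule dG_unique[OF assms has_derivative_add[OF d d]]) (simp add: bilinear_ladd bilinear_G)
    show "dG x u (c *\<^sub>R v) w = c *\<^sub>R dG x u v w" for c v
      by (rule dG_unique[OF assms has_derivative_scaleR_right[OF d]]) (simp add: bilinear_lmul bilinear_G)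
  qed
  show "linear (\<lambda>w. dG x u v w)"
  proof (rule linearI)
    show "dG x u v (w + w') = dG x u v w + dG x u v w'" for w w'
      by (rule dG_unique[OF assms has_derivative_add[OF d d]]) (simp add: bilinear_radd bilinear_G)
    show "dG x u v (c *\<^sub>R w) = c *\<^sub>R dG x u v w" for c w
      by (rule dG_unique[OF assms has_derivative_scaleR_right[OF d]]) (simp add: bilinear_rmul bilinear_G)
  qed
  show "dG x u v w = dG x u w v"
    by (rule dG_unique[OF assms d]) (use inner_form.sym[OF form] in blast)
qed

text \<open>The Koszul formula for constant coordinate fields, whose brackets vanish.\<close>

definition koszul :: "'a \<Rightarrow> 'a \<Rightarrow> 'a \<Rightarrow> 'a \<Rightarrow> real" where
  "koszul x u v w = (dG x u v w + dG x v u w - dG x w u v) / 2"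

text \<open>In the alternating sum of three compatibility equations, the symmetry of
  \<open>\<Gamma>\<close> and of the metric cancels four of the six terms and makes the other two
  equal.\<close>

lemma christoffel_koszul:
  assumes "x \<in> S" "is_christoffel G x \<Gamma>"
  shows "G x (\<Gamma> u v) w = koszul x u v w"
proof -
  have 1: "dG x u v w = G x (\<Gamma> u v) w + G x v (\<Gamma> u w)" and 2: "\<Gamma> u v = \<Gamma> v u" for u v w
    using assms(2) unfolding is_christoffel_def dG_def by auto
  show ?thesis
    unfolding koszul_def 1 using 2[of u v] 2[of w u] 2[of w v] inner_form.sym[OF form[OF assms(1)]] by simp
qed

lemma christoffel_unique:
  assumes "x \<in> S" "is_christoffel G x \<Gamma>" "is_christoffel G x \<Gamma>'"
  shows "\<Gamma> = \<Gamma>'"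
  using christoffel_koszul[OF assms(1,2)] christoffel_koszul[OF assms(1,3)]
    inner_form.nondegenerate[OF form[OF assms(1)]] by (metis ext)

text \<open>The description defining \<open>chris\<close> carries no regularity, whereas the
  geodesic equation needs smooth coefficients. So a smooth family is built from the Koszul formula,
  and uniqueness later transfers its smoothness to \<open>chris\<close>.\<close>

lemma smooth_christoffel_exists:
  "\<exists>\<Gamma>. (\<forall>x\<in>S. is_christoffel G x (\<Gamma> x)) \<and> (\<forall>u v. smooth_on S (\<lambda>x. \<Gamma> x u v))"
proof -
  have smd: "smooth_on S (\<lambda>x. dG x u v w)" for u v w
    unfolding dG_def by (rule smooth_on_derivative[OF smooth])
  have sm: "smooth_on S (\<lambda>x. koszul x u v w)" for u v w
  proof -
    have "smooth_on S (\<lambda>x. (1/2) *\<^sub>R (dG x u v w + dG x v u w - dG x w u v))"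
      by (intro smooth_on_scaleR smooth_on_add smooth_on_diff smd open_S smooth_on_const)
    then show ?thesis by (simp add: koszul_def[abs_def])
  qed
  note dG_simps = linear_add[OF dG_linear(1)] linear_add[OF dG_linear(2)] linear_add[OF dG_linear(3)]
    linear_scale[OF dG_linear(1)] linear_scale[OF dG_linear(2)] linear_scale[OF dG_linear(3)]
  have lin: "linear (koszul x u v)" if "x \<in> S" for x u v
    by (rule linearI) (simp_all add: koszul_def dG_simps[OF that] field_simps)
  have "\<exists>w. smooth_on S w \<and> (\<forall>x\<in>S. \<forall>z. G x (w x) z = koszul x u v z)" for u v
    using smooth_solution[of "\<lambda>x. koszul x u v"] sm lin by blast
  then obtain W where W: "\<And>u v. smooth_on S (W u v)" "\<And>u v x z. x \<in> S \<Longrightarrow> G x (W u v x) z = koszul x u v z"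
    by metis
  have "is_christoffel G x (\<lambda>u v. W u v x)" if x: "x \<in> S" for x
  proof -
    interpret inner_form "G x" using form x by blast
    have "bilinear (\<lambda>u v. W u v x)"
      unfolding bilinear_def
      by (intro conjI allI linearI nondegenerate)
        (simp_all add: simps W(2)[OF x], simp_all add: koszul_def dG_simps[OF x] field_simps)
    moreover have "W u v x = W v u x" for u v
      by (rule nondegenerate) (simp add: W(2)[OF x] koszul_def dG_linear(4)[OF x, of _ u v])
    moreover have "dG x u v w = G x (W u v x) w + G x v (W u w x)" for u v w
      unfolding sym[of v] W(2)[OF x] koszul_def by (simp add: dG_linear(4)[OF x, of _ w v] field_simps dG_linear(4)[OF x, of _ w u])
    ultimately show ?thesis unfolding is_christoffel_def dG_def by blast
  qed
  then show ?thesis using W(1) by (intro exI[of _ "\<lambda>x u v. W u v x"]) auto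
qed

definition chris :: "'a \<Rightarrow> 'a \<Rightarrow> 'a \<Rightarrow> 'a" where
  "chris x = (THE \<Gamma>. is_christoffel G x \<Gamma>)"

lemma is_christoffel_chris: "x \<in> S \<Longrightarrow> is_christoffel G x (chris x)"
  unfolding chris_def using smooth_christoffel_exists christoffel_unique by (metis theI)

lemma bilinear_chris: "x \<in> S \<Longrightarrow> bilinear (chris x)"
  and chris_sym: "x \<in> S \<Longrightarrow> chris x u v = chris x v u"
  and derivative_metric: "x \<in> S \<Longrightarrow>
     frechet_derivative (\<lambda>y. G y v w) (at x) u = G x (chris x u v) w + G x v (chris x u w)"
  using is_christoffel_chris unfolding is_christoffel_def by auto

lemma smooth_chris: "smooth_on S (\<lambda>x. chris x u v)"
proof -
  obtain \<Gamma> where \<Gamma>: "\<And>x. x \<in> S \<Longrightarrow> is_christoffel G x (\<Gamma> x)" "smooth_on S (\<lambda>x. \<Gamma> x u v)"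
    using smooth_christoffel_exists by blast
  show ?thesis
    by (rule smooth_on_cong[OF open_S _ \<Gamma>(2)]) (metis christoffel_unique \<Gamma>(1) is_christoffel_chris)
qed

end

section \<open>Local solutions of ordinary differential equations\<close>

text \<open>On the compact ball the partial derivatives are bounded, the sum of their bounds
  dominates the operator norm, and convexity permits the mean value inequality.\<close>

lemma smooth_locally_lipschitz:
  fixes f :: "'a::euclidean_space \<Rightarrow> 'b::real_normed_vector"
  assumes "open S" "smooth_on S f" "cball x0 r \<subseteq> S"
  obtains L where "L \<ge> 0" "\<And>x y. x \<in> cball x0 r \<Longrightarrow> y \<in> cball x0 r \<Longrightarrow> norm (f x - f y) \<le> L * norm (x - y)"
proof -
  have "\<exists>B. \<forall>x\<in>cball x0 r. norm (frechet_derivative f (at x) b) \<le> B" for b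
  proof -
    have "continuous_on (cball x0 r) (\<lambda>x. frechet_derivative f (at x) b)"
      using smooth_on_continuous[OF smooth_on_derivative[OF assms(2)]] assms(3) continuous_on_subset by blast
    then have "bounded ((\<lambda>x. frechet_derivative f (at x) b) ` cball x0 r)"
      using compact_continuous_image compact_imp_bounded compact_cball by blast
    then show ?thesis unfolding bounded_iff by blast
  qed
  then obtain B where B: "\<And>b x. x \<in> cball x0 r \<Longrightarrow> norm (frechet_derivative f (at x) b) \<le> B b" by metis
  define L where "L = (\<Sum>b\<in>Basis. \<bar>B b\<bar>)"
  have L: "L \<ge> 0" unfolding L_def by (auto intro: sum_nonneg)
  have D: "(f has_derivative frechet_derivative f (at x)) (at x)" if "x \<in> cball x0 r" for x
    using smooth_on_has_derivative[OF assms(2)] assms(3) that by blast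
  have "onorm (frechet_derivative f (at x)) \<le> L" if x: "x \<in> cball x0 r" for x
  proof (rule onorm_le)
    fix v
    have lin: "linear (frechet_derivative f (at x))" using D[OF x] has_derivative_linear by blast
    have "norm (frechet_derivative f (at x) v) = norm (\<Sum>b\<in>Basis. (v \<bullet> b) *\<^sub>R frechet_derivative f (at x) b)"
      by (subst linear_euclidean_expand[OF lin]) simp
    also have "\<dots> \<le> (\<Sum>b\<in>Basis. norm v * \<bar>B b\<bar>)"
    proof (rule order_trans[OF norm_sum], rule sum_mono)
      fix b :: 'a assume b: "b \<in> Basis"
      have "norm (frechet_derivative f (at x) b) \<le> \<bar>B b\<bar>" using B[OF x, of b] by linarith
      then show "norm ((v \<bullet> b) *\<^sub>R frechet_derivative f (at x) b) \<le> norm v * \<bar>B b\<bar>"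
        using Basis_le_norm[OF b, of v] by (simp add: mult_mono)
    qed
    also have "\<dots> = L * norm v" by (simp add: L_def sum_distrib_left mult.commute)
    finally show "norm (frechet_derivative f (at x) v) \<le> L * norm v" .
  qed
  then have "norm (f x - f y) \<le> L * norm (x - y)" if "x \<in> cball x0 r" "y \<in> cball x0 r" for x y
    using differentiable_bound[OF convex_cball, of x0 r f "\<lambda>x. frechet_derivative f (at x)" L x y]
      D has_derivative_at_withinI that by blast
  then show thesis using that L by blast
qed

text \<open>The vector field is made globally Lipschitz by composing it with the projection onto a ball,
  so that the Picard operator acts on all bounded continuous functions.\<close>

lemma ode_local_solution:
  fixes f :: "'a::euclidean_space \<Rightarrow> 'a"
  assumes "open S" "smooth_on S f" "x0 \<in> S"
  obtains e x where "e > 0" "x 0 = x0" "\<And>t. t \<in> {-e<..<e} \<Longrightarrow> x t \<in> S"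
    "\<And>t. t \<in> {-e<..<e} \<Longrightarrow> (x has_vector_derivative f (x t)) (at t)"
proof -
  obtain r where r: "r > 0" "cball x0 r \<subseteq> S" using assms open_contains_cball by blast
  obtain L where L: "L \<ge> 0" "\<And>x y. x \<in> cball x0 r \<Longrightarrow> y \<in> cball x0 r \<Longrightarrow> norm (f x - f y) \<le> L * norm (x - y)"
    using smooth_locally_lipschitz[OF assms(1,2) r(2)] by blast
  define P where "P = closest_point (cball x0 r)"
  define F where "F = f \<circ> P"
  have ne: "cball x0 r \<noteq> {}" using r by auto
  have P: "P x \<in> cball x0 r" for x unfolding P_def using closest_point_in_set[OF closed_cball ne] .
  have Flip: "norm (F x - F y) \<le> L * norm (x - y)" for x y
  proof -
    have "norm (F x - F y) \<le> L * norm (P x - P y)" unfolding F_def using L(2)[OF P P] by simp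
    also have "\<dots> \<le> L * norm (x - y)"
      using closest_point_lipschitz[OF convex_cball closed_cball ne, of x y] L(1)
      by (intro mult_left_mono) (auto simp: P_def dist_norm)
    finally show ?thesis .
  qed
  have Fcont: "continuous_on UNIV F"
  proof -
    have "continuous_on UNIV P"
      unfolding P_def by (rule continuous_on_closest_point[OF convex_cball closed_cball ne])
    moreover have "continuous_on (cball x0 r) f"
      using smooth_on_continuous[OF assms(2)] r(2) continuous_on_subset by blast
    ultimately show ?thesis
      unfolding F_def o_def using P by (intro continuous_on_compose2[of "cball x0 r" f UNIV P]) blast+
  qed
  \<comment> \<open>Two iterates differ by two differences of values of \<open>I\<close>, each at
    most 2 e L times the distance; this choice makes the total factor 4 e L at most 1/2.\<close>
  define e where "e = 1 / (8 * (L + 1))"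
  have e: "e > 0" "4 * (e * L) \<le> 1/2" using L(1) by (auto simp: e_def field_simps)
  \<comment> \<open>Freezing time outside [-e, e] makes the Picard iterates bounded and continuous
    on the whole line, as members of \<open>bcontfun\<close> must be.\<close>
  define cl where "cl t = max (-e) (min e t)" for t :: real
  have cl: "cl t \<in> {-e..e}" for t using e by (auto simp: cl_def)
  have clcont: "continuous_on UNIV cl" unfolding cl_def by (intro continuous_intros)
  have comp_cont: "continuous_on T (\<lambda>s. F (apply_bcontfun \<phi> s))" for T and \<phi> :: "real \<Rightarrow>\<^sub>C 'a"
    using continuous_on_compose2[OF Fcont, of T "apply_bcontfun \<phi>"] by auto
  have integrable: "(\<lambda>s. F (apply_bcontfun \<phi> s)) integrable_on {a..b}" for a b :: real and \<phi> :: "real \<Rightarrow>\<^sub>C 'a"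
    using comp_cont by (rule integrable_continuous_interval)
  \<comment> \<open>Integrating from -e and subtracting the value at 0 handles both directions of
    time with one integral.\<close>
  define I where "I \<phi> t = integral {-e..t} (\<lambda>s. F (apply_bcontfun \<phi> s))" for \<phi> :: "real \<Rightarrow>\<^sub>C 'a" and t
  define W where "W \<phi> t = x0 + (I \<phi> (cl t) - I \<phi> 0)" for \<phi> t
  have Icont: "continuous_on {-e..e} (I \<phi>)" for \<phi>
    unfolding I_def by (rule indefinite_integral_continuous_1[OF integrable])
  have Wb: "W \<phi> \<in> bcontfun" for \<phi>
  proof -
    have c: "continuous_on UNIV (\<lambda>t. I \<phi> (cl t))"
      by (rule continuous_on_compose2[OF Icont clcont]) (use cl in blast)
    have "bounded (I \<phi> ` {-e..e})"
      using compact_continuous_image[OF Icont] compact_imp_bounded by blast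
    then obtain b where "\<And>t. t \<in> {-e..e} \<Longrightarrow> norm (I \<phi> t) \<le> b" unfolding bounded_iff by blast
    then have b: "norm (I \<phi> (cl t)) \<le> b" for t using cl by blast
    have "norm (W \<phi> t) \<le> norm x0 + (b + norm (I \<phi> 0))" for t
      unfolding W_def using b[of t] by (meson add_left_mono add_right_mono norm_triangle_ineq norm_triangle_ineq4 order_trans)
    then show ?thesis
      using c unfolding W_def by (intro bcontfun_normI) (auto intro!: continuous_intros simp: W_def)
  qed
  have Idiff: "norm (I \<phi> t - I \<psi> t) \<le> L * dist \<phi> \<psi> * (2 * e)" if "t \<in> {-e..e}" for \<phi> \<psi> t
  proof -
    have "I \<phi> t - I \<psi> t = integral {-e..t} (\<lambda>s. F (apply_bcontfun \<phi> s) - F (apply_bcontfun \<psi> s))"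
      unfolding I_def by (rule integral_diff[symmetric]) (rule integrable)+
    also have "norm \<dots> \<le> L * dist \<phi> \<psi> * (t - (-e))"
    proof (rule integral_bound)
      show "continuous_on {-e..t} (\<lambda>s. F (apply_bcontfun \<phi> s) - F (apply_bcontfun \<psi> s))"
        by (intro continuous_intros comp_cont)
      show "norm (F (apply_bcontfun \<phi> s) - F (apply_bcontfun \<psi> s)) \<le> L * dist \<phi> \<psi>" for s
        using Flip[of "apply_bcontfun \<phi> s" "apply_bcontfun \<psi> s"] dist_bounded[of \<phi> s \<psi>] L(1)
        by (metis dist_norm mult_left_mono order_trans)
    qed (use that in auto)
    also have "\<dots> \<le> L * dist \<phi> \<psi> * (2 * e)"
      using that L(1) by (intro mult_left_mono) auto
    finally show ?thesis .
  qed
  have contr: "dist (Bcontfun (W \<phi>)) (Bcontfun (W \<psi>)) \<le> 1/2 * dist \<phi> \<psi>" for \<phi> \<psi>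
  proof (rule dist_bound)
    fix t
    have "dist (W \<phi> t) (W \<psi> t) = norm ((I \<phi> (cl t) - I \<psi> (cl t)) - (I \<phi> 0 - I \<psi> 0))"
      by (simp add: W_def dist_norm algebra_simps)
    also have "\<dots> \<le> L * dist \<phi> \<psi> * (2 * e) + L * dist \<phi> \<psi> * (2 * e)"
      using Idiff[OF cl[of t], of \<phi> \<psi>] Idiff[of 0 \<phi> \<psi>] e(1)
      by (intro order_trans[OF norm_triangle_ineq4[of "I \<phi> (cl t) - I \<psi> (cl t)"]] add_mono) auto
    also have "\<dots> = 4 * (e * L) * dist \<phi> \<psi>" by (simp add: algebra_simps)
    also have "\<dots> \<le> 1/2 * dist \<phi> \<psi>" using e(2) by (intro mult_right_mono) auto
    finally show "dist (apply_bcontfun (Bcontfun (W \<phi>)) t) (apply_bcontfun (Bcontfun (W \<psi>)) t) \<le> 1/2 * dist \<phi> \<psi>"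
      by (simp add: Bcontfun_inverse[OF Wb])
  qed
  then obtain \<phi> where "Bcontfun (W \<phi>) = \<phi>"
    using banach_fix_type[of "1/2" "\<lambda>\<phi>. Bcontfun (W \<phi>)"] by auto
  then have fp: "apply_bcontfun \<phi> t = W \<phi> t" for t using Bcontfun_inverse[OF Wb, of \<phi>] by simp
  define x where "x = apply_bcontfun \<phi>"
  have x0: "x 0 = x0" using e(1) by (simp add: x_def fp W_def cl_def)
  have xint: "x t = x0 + (I \<phi> t - I \<phi> 0)" if "t \<in> {-e..e}" for t
    using that by (simp add: x_def fp W_def cl_def)
  have dx: "(x has_vector_derivative F (x t)) (at t)" if t: "t \<in> {-e<..<e}" for t
  proof -
    have "(I \<phi> has_vector_derivative F (x t)) (at t within {-e..e})"
      unfolding I_def x_def using integral_has_vector_derivative[OF comp_cont, of t "-e" e \<phi>] t by auto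
    then have "((\<lambda>t. x0 + (I \<phi> t - I \<phi> 0)) has_vector_derivative F (x t)) (at t within {-e..e})"
      by (auto intro!: derivative_eq_intros)
    then have "((\<lambda>t. x0 + (I \<phi> t - I \<phi> 0)) has_vector_derivative F (x t)) (at t)"
      using t by (simp add: at_within_Icc_at)
    then show ?thesis
      by (rule has_vector_derivative_transform_within_open[of _ _ _ "{-e<..<e}"]) (use t xint in auto)
  qed
  \<comment> \<open>By continuity the solution stays in the ball for a short time; there the
    projection is the identity and \<open>F\<close> agrees with \<open>f\<close>.\<close>
  have "isCont x 0" using dx[of 0] e(1) has_vector_derivative_continuous by auto
  then obtain d where d: "d > 0" "\<And>t. dist t 0 < d \<Longrightarrow> dist (x t) x0 < r"
    using r(1) x0 unfolding continuous_at_eps_delta by metis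
  show thesis
  proof (rule that[of "min d e" x])
    fix t assume t: "t \<in> {-min d e<..<min d e}"
    then have "dist t 0 < d" and te: "t \<in> {-e<..<e}" by auto
    then have xr: "x t \<in> cball x0 r" using d(2)[of t] by (simp add: dist_commute)
    then show "x t \<in> S" using r by blast
    have "F (x t) = f (x t)" using xr by (simp add: F_def P_def closest_point_self)
    then show "(x has_vector_derivative f (x t)) (at t)" using dx[OF te] by simp
  qed (use d e x0 in auto)
qed

text \<open>Bootstrapping: the derivative of \<open>x\<close> is \<open>f\<close> composed with
  \<open>x\<close>, so order k for \<open>x\<close> gives order k for its derivative, hence order k
  + 1 for \<open>x\<close>.\<close>

lemma ode_solution_smooth:
  fixes f :: "'a::euclidean_space \<Rightarrow> 'a"
  assumes "open S" "smooth_on S f" "open J" "x ` J \<subseteq> S"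
    and x: "\<And>t. t \<in> J \<Longrightarrow> (x has_vector_derivative f (x t)) (at t)"
  shows "smooth_on J x"
  unfolding smooth_on_def
proof
  fix k show "Ck_on k J x"
  proof (induction k)
    case 0
    have "isCont x t" if "t \<in> J" for t using has_vector_derivative_continuous[OF x[OF that]] .
    then show ?case by (simp add: continuous_at_imp_continuous_on)
  next
    case (Suc k)
    have D: "(x has_derivative (\<lambda>v. v *\<^sub>R f (x t))) (at t)" if "t \<in> J" for t
      using x[OF that] by (simp add: has_vector_derivative_def)
    have "Ck_on k J (\<lambda>t. f (x t))"
      by (rule Ck_on_compose[OF assms(3,1,4) Suc]) (use assms(2) in \<open>simp add: smooth_on_def\<close>)
    then have *: "Ck_on k J (\<lambda>t. v *\<^sub>R f (x t))" for v
      by (intro Ck_on_scaleR assms) simp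
    have "Ck_on k J (\<lambda>t. frechet_derivative x (at t) v)" for v
      by (rule Ck_on_cong[OF assms(3) _ *[of v]]) (use frechet_derivative_at[OF D] in metis)
    then show ?case using D by (auto simp: differentiable_def)
  qed
qed

lemma smooth_on_Pair:
  assumes "open S" "smooth_on S f" "smooth_on S g"
  shows "smooth_on S (\<lambda>x. (f x, g x))"
proof -
  have "smooth_on S (\<lambda>x. (f x, 0) + (0, g x))"
    by (intro smooth_on_add smooth_on_linear[of "\<lambda>y. (y, 0)"] smooth_on_linear[of "\<lambda>y. (0, y)"] assms
        bounded_linear_Pair bounded_linear_ident bounded_linear_zero)
  then show ?thesis by simp
qed

section \<open>Local existence of geodesics\<close>

context coordinate_metric
begin

text \<open>The second-order equation becomes a first-order system for the pair of position and
  velocity, namely the geodesic spray on \<open>S\<close> times the whole coordinate space.\<close>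

lemma geodesic_equation_solution:
  assumes "p \<in> S"
  obtains e x w where "e > 0" "x 0 = p" "w 0 = v" "smooth_on {-e<..<e} x"
    "\<And>t. t \<in> {-e<..<e} \<Longrightarrow> x t \<in> S"
    "\<And>t. t \<in> {-e<..<e} \<Longrightarrow> (x has_vector_derivative w t) (at t)"
    "\<And>t. t \<in> {-e<..<e} \<Longrightarrow> (w has_vector_derivative - chris (x t) (w t) (w t)) (at t)"
proof -
  let ?T = "S \<times> (UNIV :: 'a set)"
  let ?f = "\<lambda>z. (snd z, - chris (fst z) (snd z) (snd z))"
  have T: "open ?T" using open_S by (intro open_Times) auto
  have sfst: "smooth_on ?T fst" and ssnd: "smooth_on ?T snd"
    using smooth_on_linear[OF bounded_linear_fst smooth_on_ident[OF T] T]
      smooth_on_linear[OF bounded_linear_snd smooth_on_ident[OF T] T] by auto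
  have sij: "smooth_on ?T (\<lambda>z. chris (fst z) i j)" for i j
    by (rule smooth_on_compose[OF T open_S _ sfst smooth_chris]) auto
  have sc: "smooth_on ?T (\<lambda>z. chris (fst z) (snd z) (snd z))"
    by (rule smooth_on_bilinear[where G = "\<lambda>z. chris (fst z)", OF T _ sij ssnd ssnd])
      (metis bilinear_chris mem_Times_iff)
  have f: "smooth_on ?T ?f"
    by (rule smooth_on_Pair[OF T ssnd smooth_on_minus[OF sc T]])
  obtain e z where z: "e > 0" "z 0 = (p, v)" "\<And>t. t \<in> {-e<..<e} \<Longrightarrow> z t \<in> ?T"
    "\<And>t. t \<in> {-e<..<e} \<Longrightarrow> (z has_vector_derivative ?f (z t)) (at t)"
    using ode_local_solution[OF T f, of "(p, v)"] assms by auto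
  have sz: "smooth_on {-e<..<e} z"
    by (rule ode_solution_smooth[OF T f]) (use z(3,4) in \<open>(blast | simp)+\<close>)
  show thesis
  proof (rule that[of e "fst \<circ> z" "snd \<circ> z"])
    show "smooth_on {-e<..<e} (fst \<circ> z)"
      using smooth_on_linear[OF bounded_linear_fst sz] by (simp add: o_def)
    fix t assume t: "t \<in> {-e<..<e}"
    show "(fst \<circ> z) t \<in> S" using z(3)[OF t] by auto
    show "(fst \<circ> z has_vector_derivative (snd \<circ> z) t) (at t)"
      using bounded_linear.has_vector_derivative[OF bounded_linear_fst z(4)[OF t]] by (simp add: o_def)
    show "(snd \<circ> z has_vector_derivative - chris ((fst \<circ> z) t) ((snd \<circ> z) t) ((snd \<circ> z) t)) (at t)"
      using bounded_linear.has_vector_derivative[OF bounded_linear_snd z(4)[OF t]] by (simp add: o_def)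
  qed (use z in auto)
qed

end

section \<open>Maps between coordinate metrics\<close>

locale coordinate_map =
  dom: coordinate_metric S G + cod: coordinate_metric T H
  for S :: "'a::euclidean_space set" and G and T :: "'b::euclidean_space set" and H +
  fixes \<phi> :: "'a \<Rightarrow> 'b"
  assumes maps: "x \<in> S \<Longrightarrow> \<phi> x \<in> T"
    and smooth_map: "smooth_on S \<phi>"
begin

definition D :: "'a \<Rightarrow> 'a \<Rightarrow> 'b" where
  "D x = frechet_derivative \<phi> (at x)"

definition D2 :: "'a \<Rightarrow> 'a \<Rightarrow> 'a \<Rightarrow> 'b" where
  "D2 x u v = frechet_derivative (\<lambda>y. D y v) (at x) u"

text \<open>\<open>sff\<close> is the second fundamental form \<open>\<nabla>\<phi>\<^sub>*\<close>, evaluated on fields with constant components.\<close>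

definition sff :: "'a \<Rightarrow> 'a \<Rightarrow> 'a \<Rightarrow> 'b" where
  "sff x u v = D2 x u v + cod.chris (\<phi> x) (D x u) (D x v) - D x (dom.chris x u v)"

definition pullback :: "'a \<Rightarrow> 'a \<Rightarrow> 'a \<Rightarrow> real" where
  "pullback x u v = H (\<phi> x) (D x u) (D x v)"

lemma has_derivative_map: "x \<in> S \<Longrightarrow> (\<phi> has_derivative D x) (at x)"
  unfolding D_def by (rule smooth_on_has_derivative[OF smooth_map])

lemma linear_D: "x \<in> S \<Longrightarrow> linear (D x)"
  using has_derivative_map has_derivative_linear by blast

lemma smooth_D: "smooth_on S (\<lambda>x. D x v)"
  unfolding D_def by (rule smooth_on_derivative[OF smooth_map])

lemma has_derivative_D: "x \<in> S \<Longrightarrow> ((\<lambda>y. D y v) has_derivative (\<lambda>u. D2 x u v)) (at x)"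
  unfolding D2_def by (rule smooth_on_has_derivative[OF smooth_D])

lemma D2_sym: "x \<in> S \<Longrightarrow> D2 x u v = D2 x v u"
  unfolding D2_def D_def by (rule second_derivative_symmetric[OF dom.open_S smooth_map])

text \<open>Linearity in the direction of differentiation is automatic; the symmetry of second
  derivatives carries it over to the other argument.\<close>

lemma bilinear_D2: "x \<in> S \<Longrightarrow> bilinear (D2 x)"
proof -
  assume x: "x \<in> S"
  have 1: "linear (\<lambda>u. D2 x u v)" for v using has_derivative_D[OF x] has_derivative_linear by blast
  have "D2 x u = (\<lambda>v. D2 x v u)" for u using D2_sym[OF x] by auto
  then show ?thesis using 1 unfolding bilinear_def by metis
qed

lemma bilinear_compose_linear:
  assumes "bilinear B" "linear L"
  shows "bilinear (\<lambda>u v. B (L u) (L v))"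
  using assms linear_compose[of L "\<lambda>x. B x _"] linear_compose[of L "B _"]
  unfolding bilinear_def o_def by blast

lemma bilinear_sff: "x \<in> S \<Longrightarrow> bilinear (sff x)"
proof -
  assume x: "x \<in> S"
  have 1: "bilinear (D2 x)" "bilinear (\<lambda>u v. cod.chris (\<phi> x) (D x u) (D x v))"
    using bilinear_D2[OF x] bilinear_compose_linear[OF cod.bilinear_chris[OF maps[OF x]] linear_D[OF x]] by auto
  have 2: "bilinear (\<lambda>u v. D x (dom.chris x u v))"
    using dom.bilinear_chris[OF x] linear_compose[OF _ linear_D[OF x]] unfolding bilinear_def o_def by blast
  show ?thesis
    using 1 2 unfolding bilinear_def sff_def by (intro conjI allI linear_compose_sub linear_compose_add) blast+
qed

lemma sff_sym: "x \<in> S \<Longrightarrow> sff x u v = sff x v u"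
  unfolding sff_def using D2_sym dom.chris_sym cod.chris_sym maps by metis

lemma bilinear_pullback: "x \<in> S \<Longrightarrow> bilinear (pullback x)"
  unfolding pullback_def by (rule bilinear_compose_linear[OF cod.bilinear_G[OF maps] linear_D])

lemma pullback_sym: "x \<in> S \<Longrightarrow> pullback x u v = pullback x v u"
  unfolding pullback_def using inner_form.sym[OF cod.form] maps by blast

lemma smooth_pullback: "smooth_on S (\<lambda>x. pullback x u v)"
  unfolding pullback_def
  by (rule smooth_on_bilinear[where G = "\<lambda>x. H (\<phi> x)", OF dom.open_S cod.bilinear_G[OF maps] _ smooth_D smooth_D])
    (use smooth_on_compose[OF dom.open_S cod.open_S _ smooth_map cod.smooth] maps in blast)+

text \<open>This is metric compatibility of the pullback connection: \<open>sff\<close> plus the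
  image of the Christoffel term is the covariant derivative of the image of a constant field.
  Restriction to the straight line in direction \<open>u\<close> reduces it to the product rule
  along a curve.\<close>

lemma derivative_pullback:
  assumes x: "x \<in> S"
  shows "frechet_derivative (\<lambda>y. pullback y v w) (at x) u =
     H (\<phi> x) (sff x u v + D x (dom.chris x u v)) (D x w) + H (\<phi> x) (D x v) (sff x u w + D x (dom.chris x u w))"
proof -
  let ?c = "\<lambda>t. x + t *\<^sub>R u"
  have c: "(?c has_vector_derivative u) (at 0)" by (auto intro!: derivative_eq_intros)
  have chain: "((\<lambda>t. h (?c t)) has_vector_derivative h' u) (at 0)"
    if "(h has_derivative h') (at x)" for h :: "'a \<Rightarrow> 'c::real_normed_vector" and h'
    using vector_derivative_diff_chain_within[of ?c u 0 UNIV h h'] c has_derivative_at_withinI[OF that]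
    by (simp add: o_def)
  let ?x = "\<lambda>t. \<phi> (?c t)"
  have 1: "((\<lambda>t. H (?x t) (D (?c t) v) (D (?c t) w)) has_real_derivative
    frechet_derivative (\<lambda>y. H y (D (?c 0) v) (D (?c 0) w)) (at (?x 0)) (D x u) + H (?x 0) (D2 x u v) (D (?c 0) w)
      + H (?x 0) (D (?c 0) v) (D2 x u w)) (at 0)"
    by (rule bilinear_along_curve_derivative[OF cod.open_S cod.bilinear_G cod.smooth
         chain[OF has_derivative_map[OF x]] _ chain[OF has_derivative_D[OF x]] chain[OF has_derivative_D[OF x]]])
       (use maps[OF x] in auto)
  have 2: "((\<lambda>t. pullback (?c t) v w) has_real_derivative frechet_derivative (\<lambda>y. pullback y v w) (at x) u) (at 0)"
    using chain[OF smooth_on_has_derivative[OF smooth_pullback x]]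
    by (simp add: has_real_derivative_iff_has_vector_derivative)
  note add = bilinear_ladd[OF cod.bilinear_G[OF maps[OF x]]] bilinear_radd[OF cod.bilinear_G[OF maps[OF x]]]
  have "frechet_derivative (\<lambda>y. pullback y v w) (at x) u =
    frechet_derivative (\<lambda>y. H y (D x v) (D x w)) (at (\<phi> x)) (D x u) + H (\<phi> x) (D2 x u v) (D x w)
      + H (\<phi> x) (D x v) (D2 x u w)"
    using DERIV_unique[OF 2[unfolded pullback_def] 1] by (simp add: pullback_def)
  also have "\<dots> = H (\<phi> x) (sff x u v + D x (dom.chris x u v)) (D x w)
     + H (\<phi> x) (D x v) (sff x u w + D x (dom.chris x u w))"
    by (simp add: cod.derivative_metric[OF maps[OF x]] sff_def add)
  finally show ?thesis .
qed

text \<open>The form \<open>H (sff u v) (D w)\<close> is symmetric in \<open>u\<close>, \<open>v\<close> and skew in \<open>v\<close>, \<open>w\<close>, hence zero.\<close>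

lemma isometry_sff_eq_0:
  assumes iso: "\<And>x u v. x \<in> S \<Longrightarrow> pullback x u v = G x u v"
    and x: "x \<in> S" and surj: "surj (D x)"
  shows "sff x u v = 0"
proof -
  interpret H: inner_form "H (\<phi> x)" using cod.form maps[OF x] by blast
  define K where "K u v w = H (\<phi> x) (sff x u v) (D x w)" for u v w
  have skew: "K u v w + K u w v = 0" for u v w
  proof -
    have "frechet_derivative (\<lambda>y. pullback y v w) (at x) u = frechet_derivative (\<lambda>y. G y v w) (at x) u"
      by (rule fun_cong[OF frechet_derivative_cong_open[OF dom.open_S x iso]])
    also have "\<dots> = pullback x (dom.chris x u v) w + pullback x v (dom.chris x u w)"
      by (simp add: dom.derivative_metric[OF x] iso[OF x])
    finally show ?thesis
      unfolding derivative_pullback[OF x] by (simp add: K_def pullback_def H.simps H.sym[of "D x v"])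
  qed
  have symm: "K u v w = K v u w" for u v w unfolding K_def using sff_sym[OF x] by metis
  have K0: "K u v w = 0" for u v w
    using skew[of u v w] skew[of v u w] skew[of w u v] symm[of u v w] symm[of u w v] symm[of v w u] by linarith
  obtain w where "sff x u v = D x w" using surj by (meson surjD)
  then show ?thesis using K0[of u v w] H.eq_0_iff[of "D x w"] by (simp add: K_def)
qed

end

section \<open>Clairaut conformal submersions in coordinates\<close>

locale conformal_coordinates = coordinate_map +
  fixes l :: "'a \<Rightarrow> real"
  assumes smooth_l: "smooth_on S l"
    and l_pos: "x \<in> S \<Longrightarrow> l x > 0"
    and surj_D: "x \<in> S \<Longrightarrow> surj (D x)"
    and conformal: "x \<in> S \<Longrightarrow> u \<in> inner_form.ortho_compl (G x) {z. D x z = 0} \<Longrightarrow>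
       v \<in> inner_form.ortho_compl (G x) {z. D x z = 0} \<Longrightarrow> pullback x u v = (l x)\<^sup>2 * G x u v"
begin

abbreviation "ver x \<equiv> {z. D x z = 0}"
abbreviation "hor x \<equiv> inner_form.ortho_compl (G x) (ver x)"

text \<open>The differential of log l rather than of l.\<close>

definition dl :: "'a \<Rightarrow> 'a \<Rightarrow> real" where
  "dl x v = frechet_derivative l (at x) v / l x"

lemma subspace_ver: "x \<in> S \<Longrightarrow> subspace (ver x)"
  using linear_subspace_kernel[OF linear_D] by blast

lemma hor_ver_decomposition:
  assumes "x \<in> S"
  obtains h v where "h \<in> hor x" "v \<in> ver x" "w = h + v"
  using inner_form.ortho_decomposition[OF dom.form[OF assms] subspace_ver[OF assms]] by metis

lemma hor_ver_orthogonal: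
  assumes "x \<in> S" "h \<in> hor x" "v \<in> ver x"
  shows "G x h v = 0" "G x v h = 0"
  using assms inner_form.sym[OF dom.form[OF assms(1)], of v h]
  unfolding inner_form.ortho_compl_def[OF dom.form[OF assms(1)]] by auto

lemma subspace_hor: "x \<in> S \<Longrightarrow> subspace (hor x)"
  by (rule inner_form.subspace_ortho_compl[OF dom.form])

lemma pullback_ver:
  assumes "x \<in> S" "v \<in> ver x"
  shows "pullback x v w = 0" "pullback x w v = 0"
proof -
  show "pullback x v w = 0"
    using assms(2) bilinear_lzero[OF cod.bilinear_G[OF maps[OF assms(1)]]] by (simp add: pullback_def)
  then show "pullback x w v = 0" using pullback_sym[OF assms(1)] by metis
qed

text \<open>One horizontal argument is enough: the vertical part of the other is annihilated by the
  differential on one side and orthogonal to \<open>h\<close> on the other.\<close>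

lemma pullback_hor:
  assumes x: "x \<in> S" and h: "h \<in> hor x"
  shows "pullback x h w = (l x)\<^sup>2 * G x h w" "pullback x w h = (l x)\<^sup>2 * G x h w"
proof -
  obtain k v where kv: "k \<in> hor x" "v \<in> ver x" "w = k + v" using hor_ver_decomposition[OF x] .
  show 1: "pullback x h w = (l x)\<^sup>2 * G x h w"
    using conformal[OF x h kv(1)] pullback_ver[OF x kv(2)] hor_ver_orthogonal[OF x h kv(2)]
    by (simp add: kv(3) bilinear_radd[OF bilinear_pullback[OF x]] bilinear_radd[OF dom.bilinear_G[OF x]])
  then show "pullback x w h = (l x)\<^sup>2 * G x h w" using pullback_sym[OF x] by metis
qed

text \<open>The differential sees only the horizontal part of \<open>w\<close>, so the two sides
  differ by l^2 times the squared length of the vertical part. For a fixed \<open>w\<close> this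
  holds at every point, which is what an extremum argument with constant components
  requires.\<close>

lemma pullback_le: "x \<in> S \<Longrightarrow> pullback x w w \<le> (l x)\<^sup>2 * G x w w"
proof -
  assume x: "x \<in> S"
  interpret inner_form "G x" using dom.form x by blast
  obtain h v where hv: "h \<in> hor x" "v \<in> ver x" "w = h + v" using hor_ver_decomposition[OF x] .
  have "pullback x w w = pullback x h h"
    by (simp add: hv(3) bilinear_radd[OF bilinear_pullback[OF x]] bilinear_ladd[OF bilinear_pullback[OF x]]
        pullback_ver[OF x hv(2)])
  also have "\<dots> = (l x)\<^sup>2 * G x h h" by (rule pullback_hor[OF x hv(1)])
  finally have "pullback x w w = (l x)\<^sup>2 * G x h h" .
  moreover have "G x w w = G x h h + G x v v"
    using hor_ver_orthogonal[OF x hv(1,2)] by (simp add: hv(3) simps)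
  ultimately show ?thesis using nonneg[of v] by (simp add: algebra_simps)
qed

lemma linear_dl: "x \<in> S \<Longrightarrow> linear (dl x)"
proof -
  assume x: "x \<in> S"
  have "linear (frechet_derivative l (at x))"
    using smooth_on_has_derivative[OF smooth_l x] has_derivative_linear by blast
  then have "linear (\<lambda>v. (1 / l x) *\<^sub>R frechet_derivative l (at x) v)"
    by (rule linear_compose_scale_right)
  then show ?thesis by (simp add: dl_def[abs_def])
qed

text \<open>With \<open>h\<close> extended constantly, \<open>l\<^sup>2 G h h - pullback h h\<close> is nonnegative and vanishes at \<open>x\<close>,
  so its derivative vanishes there.\<close>

lemma sff_hor:
  assumes x: "x \<in> S" and h: "h \<in> hor x"
  shows "H (\<phi> x) (sff x z h) (D x h) = (l x)\<^sup>2 * dl x z * G x h h"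
proof -
  interpret H: inner_form "H (\<phi> x)" using cod.form maps[OF x] by blast
  let ?f = "\<lambda>y. (l y)\<^sup>2 * G y h h - pullback y h h"
  let ?f' = "\<lambda>z. (l x)\<^sup>2 * frechet_derivative (\<lambda>y. G y h h) (at x) z
     + 2 * frechet_derivative l (at x) z * l x * G x h h - frechet_derivative (\<lambda>y. pullback y h h) (at x) z"
  have "(?f has_derivative ?f') (at x)"
    by (auto intro!: derivative_eq_intros smooth_on_has_derivative[OF smooth_l x]
       smooth_on_has_derivative[OF dom.smooth x] smooth_on_has_derivative[OF smooth_pullback x])
  moreover have "?f x \<le> ?f y" if "y \<in> S" for y
    using pullback_le[OF that, of h] pullback_hor[OF x h, of h] by simp
  then have "(\<forall>y\<in>S. ?f y \<le> ?f x) \<or> (\<forall>y\<in>S. ?f x \<le> ?f y)" by blast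
  ultimately have "?f' = (\<lambda>v. 0)"
    by (rule differential_zero_maxmin[OF x dom.open_S])
  then have "?f' z = 0" by meson
  \<comment> \<open>Because \<open>h\<close> is horizontal, the Christoffel terms of the two
    derivatives agree and cancel, leaving \<open>sff\<close> and the derivative of
    \<open>l\<close>.\<close>
  moreover have "H (\<phi> x) (D x (dom.chris x z h)) (D x h) = (l x)\<^sup>2 * G x h (dom.chris x z h)"
    using pullback_hor(2)[OF x h] by (simp add: pullback_def)
  moreover have "l x * (frechet_derivative l (at x) z * G x h h) = (l x)\<^sup>2 * dl x z * G x h h"
    using l_pos[OF x] by (simp add: dl_def power2_eq_square)
  ultimately show ?thesis
    unfolding dom.derivative_metric[OF x] derivative_pullback[OF x]
    using inner_form.sym[OF dom.form[OF x], of "dom.chris x z h" h]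
    by (simp add: H.simps H.sym[of "D x h"] algebra_simps)
qed

lemma sff_hor_polarized:
  assumes x: "x \<in> S" and h: "h \<in> hor x" and k: "k \<in> hor x"
  shows "H (\<phi> x) (sff x z h) (D x k) + H (\<phi> x) (sff x z k) (D x h) = 2 * (l x)\<^sup>2 * dl x z * G x h k"
proof -
  interpret H: inner_form "H (\<phi> x)" using cod.form maps[OF x] by blast
  interpret G: inner_form "G x" using dom.form x by blast
  have "h + k \<in> hor x" using h k subspace_hor[OF x] subspace_add by blast
  from sff_hor[OF x this, of z] show ?thesis
    using sff_hor[OF x h, of z] sff_hor[OF x k, of z]
    by (simp add: bilinear_radd[OF bilinear_sff[OF x]] linear_add[OF linear_D[OF x]] H.simps G.simps
       G.sym[of k h] algebra_simps)
qed

lemma sff_hor_hor: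
  assumes x: "x \<in> S" and h: "h \<in> hor x" and k: "k \<in> hor x"
  shows "H (\<phi> x) (sff x h h) (D x k) = 2 * (l x)\<^sup>2 * dl x h * G x h k - (l x)\<^sup>2 * dl x k * G x h h"
  using sff_hor_polarized[OF x h k, of h] sff_hor[OF x h, of k] sff_sym[OF x, of h k] by simp

end

text \<open>The assumption is the squared Clairaut relation multiplied by l^2 |w|^2; the difference
  in it is l^2 times the squared length of the vertical part of the velocity. In this form there is
  no angle, projection or quotient, so it can be differentiated directly and makes sense for zero
  velocity.\<close>

locale clairaut_coordinates = conformal_coordinates +
  fixes f :: "'a \<Rightarrow> real"
  assumes smooth_f: "smooth_on S f"
    and clairaut: "0 < e \<Longrightarrow> smooth_on {-e<..<e} x \<Longrightarrow>
      (\<And>t. t \<in> {-e<..<e} \<Longrightarrow> x t \<in> S) \<Longrightarrow>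
      (\<And>t. t \<in> {-e<..<e} \<Longrightarrow> (x has_vector_derivative w t) (at t)) \<Longrightarrow>
      (\<And>t. t \<in> {-e<..<e} \<Longrightarrow> (w has_vector_derivative - dom.chris (x t) (w t) (w t)) (at t)) \<Longrightarrow>
      \<exists>k. \<forall>t\<in>{-e<..<e}. (exp (f (x t)))\<^sup>2 * ((l (x t))\<^sup>2 * G (x t) (w t) (w t) - pullback (x t) (w t) (w t))
         = k * ((l (x t))\<^sup>2 * G (x t) (w t) (w t))"
begin

abbreviation "df x \<equiv> frechet_derivative f (at x)"

lemma linear_df: "x \<in> S \<Longrightarrow> linear (df x)"
  using smooth_on_has_derivative[OF smooth_f] has_derivative_linear by blast

lemma clairaut_derivative:
  assumes p: "p \<in> S"
  shows "(l p)\<^sup>2 * df p v * G p v v - df p v * pullback p v v + dl p v * pullback p v v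
     = H (\<phi> p) (sff p v v) (D p v)"
proof -
  interpret H: inner_form "H (\<phi> p)" using cod.form maps[OF p] by blast
  obtain e x w where e: "e > 0" and x0: "x 0 = p" and w0: "w 0 = v" and sx: "smooth_on {-e<..<e} x"
    and xS: "\<And>t. t \<in> {-e<..<e} \<Longrightarrow> x t \<in> S"
    and dx: "\<And>t. t \<in> {-e<..<e} \<Longrightarrow> (x has_vector_derivative w t) (at t)"
    and dw: "\<And>t. t \<in> {-e<..<e} \<Longrightarrow> (w has_vector_derivative - dom.chris (x t) (w t) (w t)) (at t)"
    using dom.geodesic_equation_solution[OF p, of v] by metis
  obtain k where k: "\<And>t. t \<in> {-e<..<e} \<Longrightarrow>
      (exp (f (x t)))\<^sup>2 * ((l (x t))\<^sup>2 * G (x t) (w t) (w t) - pullback (x t) (w t) (w t))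
         = k * ((l (x t))\<^sup>2 * G (x t) (w t) (w t))"
    using clairaut[OF e sx xS dx dw] by blast
  have 0: "0 \<in> {-e<..<e}" using e by simp
  let ?c = "dom.chris p v v"
  have dx0: "(x has_vector_derivative v) (at 0)" using dx[OF 0] w0 by simp
  have dw0: "(w has_vector_derivative - ?c) (at 0)" using dw[OF 0] w0 x0 by simp
  have chain: "((\<lambda>t. h (x t)) has_real_derivative frechet_derivative h (at p) v) (at 0)"
    if "smooth_on S h" for h :: "'a \<Rightarrow> real"
    using vector_derivative_diff_chain_within[of x v 0 UNIV h] dx0 x0
      has_derivative_at_withinI[OF smooth_on_has_derivative[OF that p]]
    by (simp add: has_real_derivative_iff_has_vector_derivative o_def)
  define N where "N t = G (x t) (w t) (w t)" for t
  define Q where "Q t = pullback (x t) (w t) (w t)" for t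
  \<comment> \<open>A geodesic has constant speed; this is its first-order form at time 0.\<close>
  have dN: "(N has_real_derivative 0) (at 0)"
  proof -
    have "(N has_real_derivative frechet_derivative (\<lambda>y. G y (w 0) (w 0)) (at (x 0)) v
        + G (x 0) (- ?c) (w 0) + G (x 0) (w 0) (- ?c)) (at 0)"
      unfolding N_def
      by (rule bilinear_along_curve_derivative[OF dom.open_S dom.bilinear_G dom.smooth dx0 _ dw0 dw0])
        (use p x0 in auto)
    then show ?thesis
      by (simp add: x0 w0 dom.derivative_metric[OF p] bilinear_lneg[OF dom.bilinear_G[OF p]]
         bilinear_rneg[OF dom.bilinear_G[OF p]])
  qed
  \<comment> \<open>The acceleration terms of the geodesic equation cancel the Christoffel terms of
    \<open>derivative_pullback\<close>, leaving the second fundamental form.\<close>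
  have dQ: "(Q has_real_derivative 2 * H (\<phi> p) (sff p v v) (D p v)) (at 0)"
  proof -
    have "(Q has_real_derivative frechet_derivative (\<lambda>y. pullback y (w 0) (w 0)) (at (x 0)) v
        + pullback (x 0) (- ?c) (w 0) + pullback (x 0) (w 0) (- ?c)) (at 0)"
      unfolding Q_def
      by (rule bilinear_along_curve_derivative[OF dom.open_S bilinear_pullback smooth_pullback dx0 _ dw0 dw0])
        (use p x0 in auto)
    then show ?thesis
      unfolding x0 w0 derivative_pullback[OF p]
      by (simp add: pullback_def linear_neg[OF linear_D[OF p]] H.simps H.sym[of "D p v"])
  qed
  let ?a = "df p v" and ?b = "frechet_derivative l (at p) v"
  let ?r = "exp (f p)" and ?H = "H (\<phi> p) (sff p v v) (D p v)"
  have ev: "\<forall>\<^sub>F t in nhds 0. (exp (f (x t)))\<^sup>2 * ((l (x t))\<^sup>2 * N t - Q t) = k * ((l (x t))\<^sup>2 * N t)"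
    using eventually_nhds_in_open[of "{-e<..<e}" 0] 0 k unfolding N_def Q_def by (auto elim: eventually_mono)
  have lhs: "((\<lambda>t. (exp (f (x t)))\<^sup>2 * ((l (x t))\<^sup>2 * N t - Q t)) has_real_derivative
      2 * ?r\<^sup>2 * ?a * ((l p)\<^sup>2 * N 0 - Q 0) + ?r\<^sup>2 * (2 * l p * ?b * N 0 - 2 * ?H)) (at 0)"
    by (auto intro!: derivative_eq_intros chain[OF smooth_f] chain[OF smooth_l] dN dQ
       simp: x0 power2_eq_square algebra_simps)
  have rhs: "((\<lambda>t. k * ((l (x t))\<^sup>2 * N t)) has_real_derivative k * (2 * l p * ?b * N 0)) (at 0)"
    by (auto intro!: derivative_eq_intros chain[OF smooth_l] dN simp: x0 power2_eq_square algebra_simps)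
  have eq1: "2 * ?r\<^sup>2 * ?a * ((l p)\<^sup>2 * N 0 - Q 0) + ?r\<^sup>2 * (2 * l p * ?b * N 0 - 2 * ?H) = k * (2 * l p * ?b * N 0)"
    using DERIV_unique[OF lhs] rhs DERIV_cong_ev[OF refl ev refl] by blast
  have eq0: "?r\<^sup>2 * ((l p)\<^sup>2 * N 0 - Q 0) = k * ((l p)\<^sup>2 * N 0)" using k[OF 0] by (simp add: N_def Q_def x0)
  have b: "?b = l p * dl p v" using l_pos[OF p] by (simp add: dl_def)
  \<comment> \<open>As \<open>N\<close> is stationary, the derivative of the right-hand side is 2
    \<open>dl p v\<close> times that side itself, so the relation at time 0 eliminates the unknown
    \<open>k\<close>.\<close>
  have "k * (2 * l p * ?b * N 0) = 2 * dl p v * (k * ((l p)\<^sup>2 * N 0))"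
    unfolding b by (simp add: power2_eq_square algebra_simps)
  also have "\<dots> = 2 * dl p v * (?r\<^sup>2 * ((l p)\<^sup>2 * N 0 - Q 0))" using eq0 by simp
  finally have "?r\<^sup>2 * (?a * ((l p)\<^sup>2 * N 0 - Q 0) + (l p)\<^sup>2 * dl p v * N 0 - ?H) = ?r\<^sup>2 * (dl p v * ((l p)\<^sup>2 * N 0 - Q 0))"
    using eq1 unfolding b by (simp add: power2_eq_square algebra_simps)
  then have "?a * ((l p)\<^sup>2 * N 0 - Q 0) + (l p)\<^sup>2 * dl p v * N 0 - ?H = dl p v * ((l p)\<^sup>2 * N 0 - Q 0)"
    by simp
  moreover have "N 0 = G p v v" "Q 0 = pullback p v v" by (simp_all add: N_def Q_def x0 w0)
  ultimately show ?thesis by (simp add: algebra_simps)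
qed

text \<open>For vertical \<open>u\<close> every term containing the differential of the map drops
  out of \<open>clairaut_derivative\<close>, leaving only l^2 df(u) |u|^2 = 0.\<close>

lemma df_ver: 
  assumes p: "p \<in> S" and u: "u \<in> ver p"
  shows "df p u = 0"
proof (cases "u = 0")
  case True
  then show ?thesis using linear_0[OF linear_df[OF p]] by simp
next
  case False
  have "(l p)\<^sup>2 * df p u * G p u u = 0"
    using clairaut_derivative[OF p, of u] u pullback_ver[OF p u]
      bilinear_rzero[OF cod.bilinear_G[OF maps[OF p]]] by simp
  then show ?thesis using l_pos[OF p] inner_form.pos[OF dom.form[OF p] False] by simp
qed

text \<open>Along h + s u the Clairaut identity is a polynomial identity in s; its values at s = 1,
  -1 and 0 separate the degrees.\<close>

lemma
  assumes p: "p \<in> S" and u: "u \<in> ver p" and h: "h \<in> hor p"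
  shows dl_ver_aux: "dl p u * G p h h = 0"
    and sff_ver: "H (\<phi> p) (sff p u u) (D p h) = (l p)\<^sup>2 * df p h * G p u u"
proof -
  interpret H: inner_form "H (\<phi> p)" using cod.form maps[OF p] by blast
  interpret G: inner_form "G p" using dom.form p by blast
  let ?A = "\<lambda>a b. H (\<phi> p) (sff p a b) (D p h)"
  have *: "(l p)\<^sup>2 * df p h * (G p h h + s\<^sup>2 * G p u u) - df p h * ((l p)\<^sup>2 * G p h h)
      + (dl p h + s * dl p u) * ((l p)\<^sup>2 * G p h h) = ?A h h + 2 * s * ?A h u + s\<^sup>2 * ?A u u" for s
  proof -
    let ?v = "h + s *\<^sub>R u"
    have 1: "df p ?v = df p h"
      using df_ver[OF p u] by (simp add: linear_add[OF linear_df[OF p]] linear_scale[OF linear_df[OF p]])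
    have 2: "dl p ?v = dl p h + s * dl p u"
      by (simp add: linear_add[OF linear_dl[OF p]] linear_scale[OF linear_dl[OF p]])
    have 3: "G p ?v ?v = G p h h + s\<^sup>2 * G p u u"
      using hor_ver_orthogonal[OF p h u] by (simp add: G.simps power2_eq_square)
    have 4: "D p ?v = D p h"
      using u by (simp add: linear_add[OF linear_D[OF p]] linear_scale[OF linear_D[OF p]])
    then have 5: "pullback p ?v ?v = (l p)\<^sup>2 * G p h h"
      using pullback_hor[OF p h, of h] by (simp add: pullback_def)
    have 6: "sff p ?v ?v = sff p h h + (2 * s) *\<^sub>R sff p h u + s\<^sup>2 *\<^sub>R sff p u u"
      using bilinear_sff[OF p] sff_sym[OF p, of u h]
      by (simp add: bilinear_ladd bilinear_radd bilinear_lmul bilinear_rmul power2_eq_square scaleR_add_right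
         flip: scaleR_add_left)
    show ?thesis
      using clairaut_derivative[OF p, of ?v] unfolding 1 2 3 4 5 6 by (simp add: H.simps)
  qed
  have hu: "?A h u = (l p)\<^sup>2 * dl p u * G p h h"
    using sff_hor[OF p h, of u] sff_sym[OF p, of h u] by simp
  \<comment> \<open>The odd part in s equates l^2 dl(u) |h|^2 with twice \<open>?A h u\<close>,
    whereas \<open>hu\<close> equates it with \<open>?A h u\<close> itself; hence it
    vanishes.\<close>
  have "(l p)\<^sup>2 * (dl p u * G p h h) = 0"
    using *[of 1] *[of "-1"] unfolding hu by (simp add: algebra_simps)
  then show "dl p u * G p h h = 0" using l_pos[OF p] by simp
  show "?A u u = (l p)\<^sup>2 * df p h * G p u u"
    using *[of 1] *[of "-1"] *[of 0] by (simp add: algebra_simps)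
qed

text \<open>Cancelling the factor \<open>G p h h\<close> requires a nonzero horizontal vector; one
  exists because the target has positive dimension and \<open>D p\<close> is onto.\<close>

lemma dl_ver:
  assumes p: "p \<in> S" and u: "u \<in> ver p"
  shows "dl p u = 0"
proof -
  obtain b :: 'b where b: "b \<noteq> 0" using nonzero_Basis by blast
  obtain z where z: "D p z = b" using surj_D[OF p] by (metis surjD)
  obtain h v where hv: "h \<in> hor p" "v \<in> ver p" "z = h + v" using hor_ver_decomposition[OF p] .
  have "h \<noteq> 0" using hv z b by auto
  then show ?thesis using dl_ver_aux[OF p u hv(1)] inner_form.pos[OF dom.form[OF p]] by fastforce
qed

section \<open>The trace of the second fundamental form\<close>

lemma image_hor: "p \<in> S \<Longrightarrow> D p ` hor p = UNIV"
proof -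
  assume p: "p \<in> S"
  have "b \<in> D p ` hor p" for b
  proof -
    obtain z where z: "D p z = b" using surj_D[OF p] by (metis surjD)
    obtain h v where hv: "h \<in> hor p" "v \<in> ver p" "z = h + v" using hor_ver_decomposition[OF p] .
    then have "D p h = b" using z by (simp add: linear_add[OF linear_D[OF p]])
    then show ?thesis using hv by blast
  qed
  then show ?thesis by blast
qed

text \<open>A horizontal vector in the kernel is orthogonal to itself, so \<open>D p\<close> maps
  the horizontal space isomorphically onto the target.\<close>

lemma dim_hor: "p \<in> S \<Longrightarrow> dim (hor p) = DIM('b)"
proof -
  assume p: "p \<in> S"
  interpret G: inner_form "G p" using dom.form p by blast
  have "inj_on (D p) (span (hor p))"
  proof (rule inj_onI)
    fix a b assume ab: "a \<in> span (hor p)" "b \<in> span (hor p)" "D p a = D p b"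
    then have 1: "a - b \<in> hor p" using subspace_hor[OF p] span_eq_iff subspace_diff by metis
    have 2: "a - b \<in> ver p" using ab by (simp add: linear_diff[OF linear_D[OF p]])
    show "a = b" using hor_ver_orthogonal[OF p 1 2] G.eq_0_iff[of "a - b"] by simp
  qed
  then have "dim (D p ` hor p) = dim (hor p)" by (rule dim_image_eq[OF linear_D[OF p]])
  then show ?thesis using image_hor[OF p] by simp
qed

lemma tension_hor:
  assumes p: "p \<in> S" and y: "y \<in> hor p"
    and F: "inner_form.orthonormal (G p) F" "span F = UNIV"
  shows "H (\<phi> p) (\<Sum>e\<in>F. sff p e e) (D p y) =
    (l p)\<^sup>2 * ((real DIM('a) - real DIM('b)) * df p y - (real DIM('b) - 2) * dl p y)"
proof -
  interpret H: inner_form "H (\<phi> p)" using cod.form maps[OF p] by blast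
  interpret G: inner_form "G p" using dom.form p by blast
  obtain E E' where E: "G.orthonormal E" "G.orthonormal E'" "E \<subseteq> hor p" "E' \<subseteq> ver p"
    "E \<inter> E' = {}" "G.orthonormal (E \<union> E')" "span (E \<union> E') = UNIV" "card E = dim (hor p)" "card E + card E' = DIM('a)"
    using G.adapted_orthonormal_basis[OF subspace_ver[OF p]] by metis
  have fin: "finite E" "finite E'" using E G.orthonormal_finite by auto
  have cE: "real (card E) = real DIM('b)" "real (card E') = real DIM('a) - real DIM('b)"
    using E(8,9) dim_hor[OF p] by auto
  let ?T = "\<lambda>a b. H (\<phi> p) (sff p a b) (D p y)"
  have T: "bilinear ?T"
    using bilinear_sff[OF p] unfolding bilinear_def
    by (intro conjI allI; intro linear_compose[OF _ H.linear_left, unfolded o_def]; blast)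
  have unit: "G p e e = 1" if "e \<in> E \<union> E'" for e using E(6) that unfolding G.orthonormal_def by auto
  have "y = (\<Sum>e\<in>E \<union> E'. G p y e *\<^sub>R e)" using G.orthonormal_expansion[of "E \<union> E'" y] E(6,7) fin by simp
  also have "\<dots> = (\<Sum>e\<in>E. G p y e *\<^sub>R e) + (\<Sum>e\<in>E'. G p y e *\<^sub>R e)"
    using fin E(5) by (rule sum.union_disjoint)
  also have "(\<Sum>e\<in>E'. G p y e *\<^sub>R e) = 0"
    using hor_ver_orthogonal[OF p y] E(4) by (intro sum.neutral) auto
  finally have y2: "y = (\<Sum>e\<in>E. G p y e *\<^sub>R e)" by simp
  have dly: "(\<Sum>e\<in>E. dl p e * G p e y) = dl p y"
  proof -
    have "dl p y = dl p (\<Sum>e\<in>E. G p y e *\<^sub>R e)" using y2 by simp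
    also have "\<dots> = (\<Sum>e\<in>E. dl p e * G p e y)"
      by (simp add: linear_sum[OF linear_dl[OF p]] linear_scale[OF linear_dl[OF p]] G.sym[of y] mult.commute)
    finally show ?thesis by simp
  qed
  have "H (\<phi> p) (\<Sum>e\<in>F. sff p e e) (D p y) = (\<Sum>e\<in>F. ?T e e)" by (rule H.sum_left)
  also have "\<dots> = (\<Sum>e\<in>E \<union> E'. ?T e e)" by (rule G.trace_independent[OF T F E(6,7)])
  also have "\<dots> = (\<Sum>e\<in>E. ?T e e) + (\<Sum>e\<in>E'. ?T e e)"
    using fin E(5) by (rule sum.union_disjoint)
  \<comment> \<open>Up to the factor l^2, the terms 2 dl(e) G(e, y) contract to 2 dl(y), and each of
    the n unit vectors contributes - dl(y); this is the origin of n - 2.\<close>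
  also have "(\<Sum>e\<in>E. ?T e e) = (\<Sum>e\<in>E. 2 * (l p)\<^sup>2 * (dl p e * G p e y) - (l p)\<^sup>2 * dl p y)"
    using sff_hor_hor[OF p _ y] E(3) unit by (intro sum.cong) (auto simp: mult.assoc)
  also have "\<dots> = 2 * (l p)\<^sup>2 * dl p y - real DIM('b) * ((l p)\<^sup>2 * dl p y)"
    by (simp add: sum_subtractf cE dly flip: sum_distrib_left)
  also have "(\<Sum>e\<in>E'. ?T e e) = (\<Sum>e\<in>E'. (l p)\<^sup>2 * df p y)"
    using sff_ver[OF p _ y] E(4) unit by (intro sum.cong) auto
  also have "\<dots> = (real DIM('a) - real DIM('b)) * ((l p)\<^sup>2 * df p y)" by (simp add: cE)
  finally show ?thesis by (simp add: algebra_simps)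
qed

text \<open>Images of horizontal vectors fill the target space, so testing against them detects
  whether the tension vanishes. The resulting equation on horizontal vectors extends to all vectors
  because \<open>df\<close> and \<open>dl\<close> vanish on vertical ones.\<close>

lemma tension_eq_0_iff:
  assumes p: "p \<in> S" and F: "inner_form.orthonormal (G p) F" "span F = UNIV"
  shows "(\<Sum>e\<in>F. sff p e e) = 0 \<longleftrightarrow>
    (\<forall>v. (real DIM('a) - real DIM('b)) * df p v = (real DIM('b) - 2) * dl p v)"
    (is "?t = 0 \<longleftrightarrow> ?R")
proof -
  interpret H: inner_form "H (\<phi> p)" using cod.form maps[OF p] by blast
  let ?\<omega> = "\<lambda>v. (real DIM('a) - real DIM('b)) * df p v - (real DIM('b) - 2) * dl p v"
  have ten: "H (\<phi> p) ?t (D p y) = (l p)\<^sup>2 * ?\<omega> y" if "y \<in> hor p" for y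
    by (rule tension_hor[OF p that F])
  have "?t = 0 \<longleftrightarrow> (\<forall>y\<in>hor p. H (\<phi> p) ?t (D p y) = 0)"
  proof
    assume *: "\<forall>y\<in>hor p. H (\<phi> p) ?t (D p y) = 0"
    have "?t \<in> D p ` hor p" using image_hor[OF p] by simp
    then obtain y where y: "y \<in> hor p" "?t = D p y" by blast
    have "H (\<phi> p) ?t (D p y) = 0" using * y(1) by (rule bspec)
    then have "H (\<phi> p) ?t ?t = 0" using y(2) by simp
    then show "?t = 0" by (simp only: H.eq_0_iff)
  qed (simp add: H.simps)
  also have "\<dots> \<longleftrightarrow> (\<forall>y\<in>hor p. ?\<omega> y = 0)"
    using ten l_pos[OF p] by simp
  also have "\<dots> \<longleftrightarrow> (\<forall>v. ?\<omega> v = 0)"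
  proof (intro iffI allI ballI)
    fix v assume *: "\<forall>y\<in>hor p. ?\<omega> y = 0"
    obtain h u where hu: "h \<in> hor p" "u \<in> ver p" "v = h + u" using hor_ver_decomposition[OF p] .
    have "?\<omega> v = ?\<omega> h + ?\<omega> u"
      unfolding hu(3) linear_add[OF linear_df[OF p]] linear_add[OF linear_dl[OF p]] by (simp add: algebra_simps)
    then show "?\<omega> v = 0" using * hu df_ver[OF p hu(2)] dl_ver[OF p hu(2)] by simp
  qed auto
  finally show ?thesis by simp
qed

end

section \<open>Angles, chosen bases and gradients for an inner product\<close>

context inner_form
begin

text \<open>The cosine of the angle is |h| / |h + u|, so this is Pythagoras. The multiplied form
  covers h + u = 0, where the angle has the default value pi/2 but both sides are 0.\<close>

lemma sin_angle_to_ortho_compl: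
  assumes "subspace V" "h \<in> ortho_compl V" "u \<in> V"
  shows "(sin (angle_to g (ortho_compl V) (h + u)))\<^sup>2 * g (h + u) (h + u) = g u u"
proof -
  let ?v = "h + u"
  have hu: "g h u = 0" "g u h = 0" using assms sym[of u h] by (auto simp: ortho_compl_def)
  have gv: "g ?v ?v = g h h + g u u" by (simp add: simps hu)
  have proj: "orth_proj g (ortho_compl V) ?v = h"
    unfolding orth_proj_def
  proof (rule the_equality)
    show "h \<in> ortho_compl V \<and> (\<forall>s\<in>ortho_compl V. g (?v - h) s = 0)"
      using assms sym[of u] by (auto simp: ortho_compl_def)
    fix k assume k: "k \<in> ortho_compl V \<and> (\<forall>s\<in>ortho_compl V. g (?v - k) s = 0)"
    \<comment> \<open>The difference of two candidates lies in the complement and is orthogonal to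
      it, hence to itself.\<close>
    have d: "h - k \<in> ortho_compl V" using assms k subspace_diff[OF subspace_ortho_compl] by blast
    have "g (?v - k) (h - k) = 0" using k d by blast
    moreover have "g u (h - k) = 0" using d assms(3) sym[of u] by (simp add: ortho_compl_def)
    ultimately have "g (h - k) (h - k) = 0" by (simp add: simps)
    then show "k = h" by (simp add: eq_0_iff)
  qed
  show ?thesis
  proof (cases "?v = 0")
    case True
    then have "g ?v ?v = 0" by (simp add: simps)
    then show ?thesis using gv nonneg[of h] nonneg[of u] by simp
  next
    case False
    let ?q = "sqrt (g h h) / sqrt (g ?v ?v)"
    have vpos: "g ?v ?v > 0" using pos[OF False] .
    have q: "0 \<le> ?q" "?q \<le> 1"
      using vpos nonneg[of h] nonneg[of u] gv by (auto simp: divide_le_eq_1)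
    have "sin (angle_to g (ortho_compl V) ?v) = sqrt (1 - ?q\<^sup>2)"
      unfolding angle_to_def proj using q by (intro sin_arccos) auto
    moreover have "?q\<^sup>2 \<le> 1" using q by (simp add: power_le_one)
    ultimately have "(sin (angle_to g (ortho_compl V) ?v))\<^sup>2 = 1 - ?q\<^sup>2" by simp
    also have "\<dots> = 1 - g h h / g ?v ?v" using vpos nonneg[of h] by (simp add: power_divide)
    finally have "(sin (angle_to g (ortho_compl V) ?v))\<^sup>2 * g ?v ?v = g ?v ?v - g h h"
      using vpos by (simp add: left_diff_distrib)
    then show ?thesis using gv by simp
  qed
qed

lemma orthonormal_basis_iff: "orthonormal_basis g E \<longleftrightarrow> orthonormal E \<and> span E = UNIV"
  unfolding orthonormal_basis_def orthonormal_def by auto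

lemma orthonormal_basis_some: "orthonormal_basis g (SOME E. orthonormal_basis g E)"
proof (rule someI_ex)
  obtain E where "orthonormal E" "span E = UNIV"
    using orthonormal_basis_of_subspace[OF subspace_UNIV] by metis
  then show "\<exists>E. orthonormal_basis g E" unfolding orthonormal_basis_iff by blast
qed

text \<open>Expansion in an orthonormal basis gives existence and nondegeneracy gives uniqueness, so
  the description in \<open>grad\<close> has its intended value and gradients can be compared
  through differentials.\<close>

lemma riesz_representation:
  assumes "linear L"
  shows "g (THE w. \<forall>v. g w v = L v) u = L u"
proof -
  obtain E where E: "orthonormal E" "finite E" "span E = UNIV"
    using orthonormal_basis_of_subspace[OF subspace_UNIV] by metis
  have ex: "g (\<Sum>e\<in>E. L e *\<^sub>R e) v = L v" for v
  proof -
    have "v = (\<Sum>e\<in>E. g v e *\<^sub>R e)" using orthonormal_expansion E by blast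
    then have "L v = L (\<Sum>e\<in>E. g v e *\<^sub>R e)" by simp
    also have "\<dots> = (\<Sum>e\<in>E. g v e * L e)"
      by (simp add: linear_sum[OF assms] linear_scale[OF assms])
    also have "\<dots> = g (\<Sum>e\<in>E. L e *\<^sub>R e) v"
      by (simp add: sum_left simps sym[of v] mult.commute)
    finally show ?thesis by simp
  qed
  have "\<exists>!w. \<forall>v. g w v = L v" using ex nondegenerate by metis
  then show ?thesis by (rule theI'[THEN spec])
qed

end

text \<open>With a chart transition as the map, this product rule computes the acceleration of a
  curve in the new chart.\<close>

lemma (in coordinate_map) derivative_D_along_curve:
  assumes x: "x t \<in> S" "(x has_vector_derivative x') (at t)" and w: "(w has_vector_derivative w') (at t)"
  shows "((\<lambda>s. D (x s) (w s)) has_vector_derivative D2 (x t) x' (w t) + D (x t) w') (at t)"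
proof -
  have isc: "isCont x t" using x has_vector_derivative_continuous by blast
  then have ev: "\<forall>\<^sub>F s in nhds t. x s \<in> S"
    using dom.open_S x by (auto simp: eventually_nhds_conv_at isCont_def dest: topological_tendstoD)
  then obtain U where U: "open U" "t \<in> U" "\<And>s. s \<in> U \<Longrightarrow> x s \<in> S" unfolding eventually_nhds by blast
  have wd: "((\<lambda>s. w s \<bullet> b) has_real_derivative w' \<bullet> b) (at t)" for b
    using bounded_linear.has_vector_derivative[OF bounded_linear_inner_left w]
    by (simp add: has_real_derivative_iff_has_vector_derivative)
  have Db: "((\<lambda>s. D (x s) b) has_vector_derivative D2 (x t) x' b) (at t)" for b
    using vector_derivative_diff_chain_within[OF x(2), of "\<lambda>y. D y b" "\<lambda>u. D2 (x t) u b"]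
      has_derivative_at_withinI[OF has_derivative_D[OF x(1)]] by (simp add: o_def)
  have "((\<lambda>s. \<Sum>b\<in>Basis. (w s \<bullet> b) *\<^sub>R D (x s) b) has_vector_derivative
     (\<Sum>b\<in>Basis. (w t \<bullet> b) *\<^sub>R D2 (x t) x' b + (w' \<bullet> b) *\<^sub>R D (x t) b)) (at t)"
    by (intro has_vector_derivative_sum has_vector_derivative_scaleR wd Db)
  also have "(\<Sum>b\<in>Basis. (w t \<bullet> b) *\<^sub>R D2 (x t) x' b + (w' \<bullet> b) *\<^sub>R D (x t) b)
     = D2 (x t) x' (w t) + D (x t) w'"
    using linear_euclidean_expand[OF linear_D[OF x(1)], of w']
      linear_euclidean_expand[of "D2 (x t) x'" "w t"] bilinear_D2[OF x(1)]
    by (simp add: sum.distrib bilinear_def)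
  finally show ?thesis
    by (rule has_vector_derivative_transform_within_open[OF _ U(1,2)])
      (rule linear_euclidean_expand[OF linear_D[OF U(3)], symmetric])
qed

section \<open>Charts\<close>

abbreviation local_metric :: "('m, 'a) riem_mfd \<Rightarrow> ('m, 'a) chart \<Rightarrow> 'a \<Rightarrow> 'a \<Rightarrow> 'a \<Rightarrow> real" where
  "local_metric M c \<equiv> \<lambda>x. metric_tensor M c (chart_inv c x)"

context riemannian_manifold
begin

lemma chart_subset: "c \<in> atlas M \<Longrightarrow> fst c \<subseteq> points M"
  using chart_domain openin_subset by blast

lemma topspace_chart: "c \<in> atlas M \<Longrightarrow> topspace (subtopology (mtop M) (fst c)) = fst c"
  using chart_subset by (simp add: Int_absorb1)

lemma chart_inj: "c \<in> atlas M \<Longrightarrow> inj_on (snd c) (fst c)"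
  using homeomorphic_imp_injective_map[OF chart_homeo] topspace_chart by metis

lemma chart_inv_chart: "c \<in> atlas M \<Longrightarrow> p \<in> fst c \<Longrightarrow> chart_inv c (snd c p) = p"
  unfolding chart_inv_def by (rule inv_into_f_f[OF chart_inj])

lemma chart_chart_inv: "x \<in> snd c ` fst c \<Longrightarrow> snd c (chart_inv c x) = x"
  unfolding chart_inv_def by (rule f_inv_into_f)

lemma chart_inv_in: "x \<in> snd c ` fst c \<Longrightarrow> chart_inv c x \<in> fst c"
  unfolding chart_inv_def by (rule inv_into_into)

lemma open_chart_image:
  assumes "c \<in> atlas M" "openin (mtop M) U"
  shows "open (snd c ` (fst c \<inter> U))"
proof -
  have "openin (subtopology (mtop M) (fst c)) (fst c \<inter> U)"
    using assms by (simp add: openin_subtopology_Int2)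
  then have "openin (top_of_set (snd c ` fst c)) (snd c ` (fst c \<inter> U))"
    using homeomorphic_imp_open_map[OF chart_homeo[OF assms(1)]] unfolding open_map_def by blast
  then show ?thesis using chart_image[OF assms(1)] openin_open_eq by blast
qed

lemma continuous_chart_inv:
  assumes "c \<in> atlas M"
  shows "continuous_map (top_of_set (snd c ` fst c)) (mtop M) (chart_inv c)"
  unfolding continuous_map_def
proof (intro conjI allI impI)
  show "chart_inv c \<in> topspace (top_of_set (snd c ` fst c)) \<rightarrow> points M"
  proof
    fix x assume "x \<in> topspace (top_of_set (snd c ` fst c))"
    then have "chart_inv c x \<in> fst c" by (intro chart_inv_in) simp
    then show "chart_inv c x \<in> points M" using chart_subset[OF assms] by (rule subsetD[rotated])
  qed
  fix U assume U: "openin (mtop M) U"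
  have eq: "{x \<in> topspace (top_of_set (snd c ` fst c)). chart_inv c x \<in> U} = snd c ` (fst c \<inter> U)"
    by (auto simp: chart_inv_chart[OF assms])
  have "openin (top_of_set (snd c ` fst c)) (snd c ` (fst c \<inter> U))"
    unfolding openin_open_eq[OF chart_image[OF assms]] using open_chart_image[OF assms U] by blast
  then show "openin (top_of_set (snd c ` fst c)) {x \<in> topspace (top_of_set (snd c ` fst c)). chart_inv c x \<in> U}"
    unfolding eq .
qed

lemma inner_form_metric: "c \<in> charts_at M p \<Longrightarrow> inner_form (metric_tensor M c p)"
  using metric_bilinear metric_sym metric_pos by unfold_locales

lemma coordinate_metric_chart:
  assumes "c \<in> atlas M" "open S" "S \<subseteq> snd c ` fst c"
  shows "coordinate_metric S (local_metric M c)"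
proof (rule coordinate_metric.intro)
  show "open S" by (rule assms)
  show "inner_form (local_metric M c x)" if "x \<in> S" for x
  proof (rule inner_form_metric)
    have "chart_inv c x \<in> fst c" by (rule chart_inv_in) (use that assms(3) in blast)
    then show "c \<in> charts_at M (chart_inv c x)" using assms(1) by (simp add: charts_at_def)
  qed
  show "smooth_on S (\<lambda>x. local_metric M c x u v)" for u v
    using smooth_on_subset[OF metric_smooth assms(3)] assms(1) .
qed

lemma levi_civita_eq_chris:
  assumes "c \<in> charts_at M p"
  shows "levi_civita M c p = coordinate_metric.chris (local_metric M c) (snd c p)"
proof -
  have c: "c \<in> atlas M" "p \<in> fst c" using assms by (auto simp: charts_at_def)
  interpret coordinate_metric "snd c ` fst c" "local_metric M c"
    by (rule coordinate_metric_chart[OF c(1) chart_image[OF c(1)]]) simp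
  show ?thesis
    unfolding levi_civita_def chris_def is_christoffel_def chart_inv_chart[OF c] ..
qed

lemma transition_coordinate_map:
  assumes "c \<in> atlas M" "d \<in> atlas M"
  shows "coordinate_map (snd c ` (fst c \<inter> fst d)) (local_metric M c) (snd d ` fst d) (local_metric M d) (coord_map id c d)"
proof -
  interpret dom: coordinate_metric "snd c ` (fst c \<inter> fst d)" "local_metric M c"
    using coordinate_metric_chart[OF assms(1)] open_chart_image[OF assms(1) chart_domain[OF assms(2)]] by blast
  interpret cod: coordinate_metric "snd d ` fst d" "local_metric M d"
    using coordinate_metric_chart[OF assms(2) chart_image[OF assms(2)]] by blast
  show ?thesis
  proof
    show "coord_map id c d x \<in> snd d ` fst d" if "x \<in> snd c ` (fst c \<inter> fst d)" for x
      using that chart_inv_chart[OF assms(1)] by (auto simp: coord_map_def)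
    show "smooth_on (snd c ` (fst c \<inter> fst d)) (coord_map id c d)"
      by (rule transition_smooth[OF assms])
  qed
qed

text \<open>By \<open>metric_transform\<close> a chart transition is an isometry, hence injective on
  tangent vectors and, the dimensions being equal, surjective. The conclusion is the transformation
  law of the Christoffel symbols.\<close>

lemma transition_sff:
  assumes "c \<in> atlas M" "d \<in> atlas M" and x: "x \<in> snd c ` (fst c \<inter> fst d)"
  shows "coordinate_map.sff (local_metric M c) (local_metric M d) (coord_map id c d) x u v = 0"
proof -
  let ?S = "snd c ` (fst c \<inter> fst d)"
  interpret coordinate_map ?S "local_metric M c" "snd d ` fst d" "local_metric M d" "coord_map id c d"
    by (rule transition_coordinate_map[OF assms(1,2)])
  have iso: "pullback y u v = local_metric M c y u v" if y: "y \<in> ?S" for y u v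
  proof -
    obtain p where p: "p \<in> fst c" "p \<in> fst d" "y = snd c p" using y by blast
    have "metric_tensor M c p u v = metric_tensor M d p (differential id c d p u) (differential id c d p v)"
      by (rule metric_transform) (use p assms in \<open>auto simp: charts_at_def\<close>)
    moreover have "coord_map id c d y = snd d p"
      using chart_inv_chart[OF assms(1) p(1)] by (simp add: coord_map_def p(3))
    moreover have "D y = differential id c d p" unfolding D_def differential_def p(3) ..
    ultimately show ?thesis
      unfolding pullback_def
      using chart_inv_chart[OF assms(1) p(1)] chart_inv_chart[OF assms(2) p(2)] by (simp add: p(3))
  qed
  have "inj (D x)"
  proof (rule linear_injective_0[OF linear_D[OF x], THEN iffD2], intro allI impI)
    fix u assume "D x u = 0"
    then have "pullback x u u = 0"
      using bilinear_lzero[OF cod.bilinear_G[OF maps[OF x]]] by (simp add: pullback_def)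
    then show "u = 0" using iso[OF x] inner_form.eq_0_iff[OF dom.form[OF x]] by simp
  qed
  then have "surj (D x)" using linear_injective_imp_surjective[OF linear_D[OF x]] by simp
  then show ?thesis by (intro isometry_sff_eq_0 iso x)
qed

text \<open>The equation is solved in the single chart \<open>c\<close>, but \<open>geodesic\<close>
  demands it in all charts. In a chart \<open>d\<close> the velocity is the image of
  \<open>w\<close> under the differential of the transition, and the defect in the equation there is
  the second fundamental form of the transition, which vanishes.\<close>

lemma chart_curve_geodesic:
  assumes c: "c \<in> atlas M" and e: "0 < e" and smx: "smooth_on {-e<..<e} x"
    and xS: "\<And>t. t \<in> {-e<..<e} \<Longrightarrow> x t \<in> snd c ` fst c"
    and dx: "\<And>t. t \<in> {-e<..<e} \<Longrightarrow> (x has_vector_derivative w t) (at t)"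
    and dw: "\<And>t. t \<in> {-e<..<e} \<Longrightarrow> (w has_vector_derivative
         - coordinate_metric.chris (local_metric M c) (x t) (w t) (w t)) (at t)"
  shows "geodesic M {-e<..<e} (chart_inv c \<circ> x)"
    and "t \<in> {-e<..<e} \<Longrightarrow> velocity c (chart_inv c \<circ> x) t = w t"
proof -
  let ?J = "{-e<..<e}" and ?\<alpha> = "chart_inv c \<circ> x"
  have cx: "continuous_on ?J x" using smx smooth_on_continuous by blast
  define J where "J d = {t \<in> ?J. ?\<alpha> t \<in> fst d}" for d :: "('m, 'a) chart"
  have Jx: "t \<in> J d \<longleftrightarrow> t \<in> ?J \<and> x t \<in> snd c ` (fst c \<inter> fst d)" for t d
    using xS[of t] chart_inv_chart[OF c] chart_inv_in[of "x t" c] chart_chart_inv[of "x t" c]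
    by (auto simp: J_def)
  have Jopen: "open (J d)" if "d \<in> atlas M" for d
  proof -
    have "J d = ?J \<inter> x -` (snd c ` (fst c \<inter> fst d))" using Jx by blast
    then show ?thesis
      using continuous_open_preimage[OF cx _ open_chart_image[OF c chart_domain[OF that]]] by simp
  qed
  have vel: "velocity d ?\<alpha> t = coordinate_map.D (coord_map id c d) (x t) (w t)"
    if d: "d \<in> atlas M" and t: "t \<in> J d" for d t
  proof -
    interpret coordinate_map "snd c ` (fst c \<inter> fst d)" "local_metric M c" "snd d ` fst d" "local_metric M d" "coord_map id c d"
      by (rule transition_coordinate_map[OF c d])
    have t': "t \<in> ?J" "x t \<in> snd c ` (fst c \<inter> fst d)" using Jx t by auto
    have "((coord_map id c d \<circ> x) has_vector_derivative D (x t) (w t)) (at t)"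
      using vector_derivative_diff_chain_within[OF dx[OF t'(1)]] has_derivative_at_withinI[OF has_derivative_map[OF t'(2)]]
      by blast
    then show ?thesis
      unfolding velocity_def by (intro vector_derivative_at) (simp add: coord_map_def o_def)
  qed
  show "velocity c ?\<alpha> t = w t" if t: "t \<in> ?J"
  proof -
    have "((snd c \<circ> ?\<alpha>) has_vector_derivative w t) (at t)"
      by (rule has_vector_derivative_transform_within_open[OF dx[OF t] open_greaterThanLessThan t])
        (simp add: chart_chart_inv[OF xS])
    then show ?thesis unfolding velocity_def by (rule vector_derivative_at)
  qed
  show "geodesic M ?J ?\<alpha>"
    unfolding geodesic_def
  proof (intro conjI ballI)
    show "open ?J" "is_interval ?J" by (auto simp: is_interval_oo)
    have "continuous_map (top_of_set ?J) (top_of_set (snd c ` fst c)) x"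
      using cx xS by (auto simp: continuous_map_in_subtopology)
    then show "continuous_map (top_of_set ?J) (mtop M) ?\<alpha>"
      using continuous_chart_inv[OF c] by (rule continuous_map_compose)
  next
    fix d assume d: "d \<in> atlas M"
    have "smooth_on (J d) (\<lambda>t. coord_map id c d (x t))"
    proof (rule smooth_on_compose[where h = x and g = "coord_map id c d", OF Jopen[OF d] open_chart_image[OF c chart_domain[OF d]]])
      show "x ` J d \<subseteq> snd c ` (fst c \<inter> fst d)" using Jx by blast
      show "smooth_on (J d) x" by (rule smooth_on_subset[OF smx]) (auto simp: J_def)
      show "smooth_on (snd c ` (fst c \<inter> fst d)) (coord_map id c d)" by (rule transition_smooth[OF c d])
    qed
    then show "smooth_on {t \<in> ?J. ?\<alpha> t \<in> fst d} (snd d \<circ> ?\<alpha>)"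
      by (simp add: J_def coord_map_def o_def)
  next
    fix t d assume t: "t \<in> ?J" and "d \<in> charts_at M (?\<alpha> t)"
    then have d: "d \<in> atlas M" and td: "t \<in> J d" by (auto simp: charts_at_def J_def)
    have da: "d \<in> charts_at M (?\<alpha> t)" by fact
    interpret coordinate_map "snd c ` (fst c \<inter> fst d)" "local_metric M c" "snd d ` fst d" "local_metric M d" "coord_map id c d"
      by (rule transition_coordinate_map[OF c d])
    have xt: "x t \<in> snd c ` (fst c \<inter> fst d)" using Jx td by auto
    have "((\<lambda>s. D (x s) (w s)) has_vector_derivative
        D2 (x t) (w t) (w t) + D (x t) (- dom.chris (x t) (w t) (w t))) (at t)"
      by (rule derivative_D_along_curve[OF xt dx[OF t] dw[OF t]])
    then have "(velocity d ?\<alpha> has_vector_derivative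
        D2 (x t) (w t) (w t) + D (x t) (- dom.chris (x t) (w t) (w t))) (at t)"
      by (rule has_vector_derivative_transform_within_open[OF _ Jopen[OF d] td]) (simp add: vel[OF d])
    then have 1: "vector_derivative (velocity d ?\<alpha>) (at t) =
        D2 (x t) (w t) (w t) - D (x t) (dom.chris (x t) (w t) (w t))"
      by (simp add: vector_derivative_at linear_neg[OF linear_D[OF xt]])
    have 2: "levi_civita M d (?\<alpha> t) = cod.chris (coord_map id c d (x t))"
      unfolding levi_civita_eq_chris[OF da] by (simp add: coord_map_def)
    show "vector_derivative (velocity d ?\<alpha>) (at t) +
        levi_civita M d (?\<alpha> t) (velocity d ?\<alpha> t) (velocity d ?\<alpha> t) = 0"
      using transition_sff[OF c d xt, of "w t" "w t"] unfolding 1 2 vel[OF d td] sff_def by (simp add: algebra_simps)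
  qed
qed

lemma gradient_inner:
  assumes "c \<in> charts_at M p" "(f \<circ> chart_inv c) differentiable at (snd c p)"
  shows "metric_tensor M c p (grad M f c p) v = frechet_derivative (f \<circ> chart_inv c) (at (snd c p)) v"
  unfolding grad_def
  by (rule inner_form.riesz_representation[OF inner_form_metric[OF assms(1)] linear_frechet_derivative[OF assms(2)]])

end

section \<open>Clairaut conformal submersions\<close>

text \<open>\<open>vertical\<close> asks for vanishing in all charts around \<open>F p\<close>. By
  the chain rule the differentials in two such charts are related by the differential of a
  transition map, which sends 0 to 0, so one chart decides.\<close>

lemma vertical_eq_kernel:
  assumes M: "riemannian_manifold M" and B: "riemannian_manifold B" and F: "smooth_map M B F"
    and c: "c \<in> charts_at M p" and d: "d \<in> charts_at B (F p)"
  shows "vertical B F c p = {v. differential F c d p v = 0}"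
proof -
  interpret M: riemannian_manifold M by (rule M)
  interpret B: riemannian_manifold B by (rule B)
  have c': "c \<in> atlas M" "p \<in> fst c" using c by (auto simp: charts_at_def)
  have cont: "continuous_map (mtop M) (mtop B) F" using F by (simp add: smooth_map_def)
  have "differential F c d' p v = 0" if d'': "d' \<in> charts_at B (F p)" and v: "differential F c d p v = 0" for d' v
  proof -
    have d': "d \<in> atlas B" "F p \<in> fst d" "d' \<in> atlas B" "F p \<in> fst d'"
      using d d'' by (auto simp: charts_at_def)
    define U where "U = fst c \<inter> {q \<in> points M. F q \<in> fst d}"
    have "openin (mtop M) {q \<in> points M. F q \<in> fst d}"
      by (rule openin_continuous_map_preimage[OF cont B.chart_domain[OF d'(1)]])
    then have oU: "open (snd c ` U)" unfolding U_def by (rule M.open_chart_image[OF c'(1)])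
    have pU: "p \<in> U" using c' d' M.chart_subset[OF c'(1)] by (auto simp: U_def)
    then have xU: "snd c p \<in> snd c ` U" by blast
    have eqU: "coord_map F c d' x = coord_map id d d' (coord_map F c d x)" if "x \<in> snd c ` U" for x
      using that M.chart_inv_chart[OF c'(1)] B.chart_inv_chart[OF d'(1)] by (auto simp: coord_map_def U_def)
    have y: "coord_map F c d (snd c p) = snd d (F p)"
      using M.chart_inv_chart[OF c'] by (simp add: coord_map_def)
    have "smooth_on (snd c ` {p \<in> fst c. F p \<in> fst d}) (coord_map F c d)"
      using F c' d' unfolding smooth_map_def by blast
    then have 1: "(coord_map F c d has_derivative differential F c d p) (at (snd c p))"
      unfolding differential_def by (rule smooth_on_has_derivative) (use c' d' in auto)
    have 2: "(coord_map id d d' has_derivative differential id d d' (F p)) (at (snd d (F p)))"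
      unfolding differential_def
      by (rule smooth_on_has_derivative[OF B.transition_smooth[OF d'(1,3)]]) (use d' in auto)
    have "((\<lambda>x. coord_map id d d' (coord_map F c d x)) has_derivative
        (\<lambda>v. differential id d d' (F p) (differential F c d p v))) (at (snd c p))"
      using has_derivative_compose[OF 1, of "coord_map id d d'"] 2 y by simp
    then have "(coord_map F c d' has_derivative
        (\<lambda>v. differential id d d' (F p) (differential F c d p v))) (at (snd c p))"
      by (rule has_derivative_transform_within_open[OF _ oU xU]) (simp add: eqU)
    then have "differential F c d' p v = differential id d d' (F p) (differential F c d p v)"
      using frechet_derivative_at unfolding differential_def by metis
    then show ?thesis using v linear_0[OF has_derivative_linear[OF 2]] by simp
  qed
  then show ?thesis using d unfolding vertical_def by blast
qed

text \<open>The patch consists of the points of \<open>c\<close> that are mapped into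
  \<open>d\<close>. Solutions of the geodesic equation on it are geodesics of \<open>M\<close>,
  which gives access to the Clairaut condition.\<close>

lemma clairaut_coordinates_charts:
  assumes M: "riemannian_manifold M" and B: "riemannian_manifold B" and f: "smooth_fun M f"
    and cl: "clairaut_conformal_submersion M B F lam (\<lambda>p. exp (f p))"
    and c: "c \<in> atlas M" and d: "d \<in> atlas B"
  shows "clairaut_coordinates (snd c ` {p \<in> fst c. F p \<in> fst d}) (local_metric M c)
      (snd d ` fst d) (local_metric B d) (coord_map F c d) (lam \<circ> chart_inv c) (f \<circ> chart_inv c)"
proof -
  interpret M: riemannian_manifold M by (rule M)
  interpret B: riemannian_manifold B by (rule B)
  have conf: "conformal_submersion M B F lam"
    and geo: "\<And>J \<alpha>. geodesic M J \<alpha> \<Longrightarrow> \<exists>k. \<forall>t\<in>J. \<forall>c\<in>charts_at M (\<alpha> t).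
           exp (f (\<alpha> t)) * sin (angle_to (metric_tensor M c (\<alpha> t)) (horizontal M B F c (\<alpha> t)) (velocity c \<alpha> t)) = k"
    using cl unfolding clairaut_conformal_submersion_def by auto
  have sub: "submersion M B F" and lam: "smooth_fun M lam" "\<And>p. p \<in> points M \<Longrightarrow> lam p > 0"
    and con: "\<And>p c d X Y. p \<in> points M \<Longrightarrow> c \<in> charts_at M p \<Longrightarrow> d \<in> charts_at B (F p) \<Longrightarrow>
       X \<in> horizontal M B F c p \<Longrightarrow> Y \<in> horizontal M B F c p \<Longrightarrow>
          metric_tensor B d (F p) (differential F c d p X) (differential F c d p Y)
            = (lam p)\<^sup>2 * metric_tensor M c p X Y"
    using conf unfolding conformal_submersion_def by blast+
  have Fs: "smooth_map M B F"
    and surj: "\<And>p c d. p \<in> points M \<Longrightarrow> c \<in> charts_at M p \<Longrightarrow> d \<in> charts_at B (F p) \<Longrightarrow> surj (differential F c d p)"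
    using sub unfolding submersion_def by blast+
  let ?S = "snd c ` {p \<in> fst c. F p \<in> fst d}"
  have "openin (mtop M) {q \<in> points M. F q \<in> fst d}"
    using openin_continuous_map_preimage[OF _ B.chart_domain[OF d]] Fs unfolding smooth_map_def by blast
  then have "open (snd c ` (fst c \<inter> {q \<in> points M. F q \<in> fst d}))" by (rule M.open_chart_image[OF c])
  moreover have "fst c \<inter> {q \<in> points M. F q \<in> fst d} = {p \<in> fst c. F p \<in> fst d}"
    using M.chart_subset[OF c] by auto
  ultimately have oS: "open ?S" by simp
  have sS: "?S \<subseteq> snd c ` fst c" by auto
  interpret dom: coordinate_metric ?S "local_metric M c"
    by (rule M.coordinate_metric_chart[OF c oS sS])
  interpret cod: coordinate_metric "snd d ` fst d" "local_metric B d"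
    using B.coordinate_metric_chart[OF d B.chart_image[OF d]] by blast
  interpret coordinate_map ?S "local_metric M c" "snd d ` fst d" "local_metric B d" "coord_map F c d"
  proof
    show "coord_map F c d x \<in> snd d ` fst d" if "x \<in> ?S" for x
      using that M.chart_inv_chart[OF c] by (auto simp: coord_map_def)
    show "smooth_on ?S (coord_map F c d)" using Fs c d unfolding smooth_map_def by blast
  qed
  have pt: "chart_inv c x \<in> points M" "c \<in> charts_at M (chart_inv c x)" "d \<in> charts_at B (F (chart_inv c x))"
      "D x = differential F c d (chart_inv c x)"
      "local_metric B d (coord_map F c d x) = metric_tensor B d (F (chart_inv c x))"
      "horizontal M B F c (chart_inv c x) = inner_form.ortho_compl (local_metric M c x) {z. D x z = 0}"
      if x: "x \<in> ?S" for x
  proof -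
    obtain p where p: "p \<in> fst c" "F p \<in> fst d" "x = snd c p" using x by auto
    have inv: "chart_inv c x = p" using M.chart_inv_chart[OF c] p by simp
    show "chart_inv c x \<in> points M" using inv p M.chart_subset[OF c] by auto
    show ca: "c \<in> charts_at M (chart_inv c x)" and da: "d \<in> charts_at B (F (chart_inv c x))"
      using inv p c d by (auto simp: charts_at_def)
    show Dx: "D x = differential F c d (chart_inv c x)" unfolding D_def differential_def inv p(3)[symmetric] ..
    show "local_metric B d (coord_map F c d x) = metric_tensor B d (F (chart_inv c x))"
      using B.chart_inv_chart[OF d p(2)] inv by (simp add: coord_map_def)
    show "horizontal M B F c (chart_inv c x) = inner_form.ortho_compl (local_metric M c x) {z. D x z = 0}"
      unfolding horizontal_def inner_form.ortho_compl_def[OF dom.form[OF x]]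
        vertical_eq_kernel[OF M B Fs ca da] Dx ..
  qed
  interpret conformal_coordinates ?S "local_metric M c" "snd d ` fst d" "local_metric B d" "coord_map F c d" "lam \<circ> chart_inv c"
  proof
    show "smooth_on ?S (lam \<circ> chart_inv c)"
      using lam(1) c sS smooth_on_subset unfolding smooth_fun_def by blast
    show "0 < (lam \<circ> chart_inv c) x" if "x \<in> ?S" for x using lam(2) pt(1)[OF that] by simp
    show "surj (D x)" if "x \<in> ?S" for x using surj[OF pt(1-3)[OF that]] pt(4)[OF that] by simp
    show "pullback x u v = ((lam \<circ> chart_inv c) x)\<^sup>2 * local_metric M c x u v"
      if x: "x \<in> ?S" and uv: "u \<in> inner_form.ortho_compl (local_metric M c x) {z. D x z = 0}"
       "v \<in> inner_form.ortho_compl (local_metric M c x) {z. D x z = 0}" for x u v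
      using con[OF pt(1-3)[OF x], of u v] uv pt(4-6)[OF x] by (simp add: pullback_def)
  qed
  show ?thesis
  proof
    show "smooth_on ?S (f \<circ> chart_inv c)"
      using f c sS smooth_on_subset unfolding smooth_fun_def by blast
    fix e :: real and x w
    assume e: "0 < e" and smx: "smooth_on {-e<..<e} x"
      and xS: "\<And>t. t \<in> {-e<..<e} \<Longrightarrow> x t \<in> ?S"
      and dx: "\<And>t. t \<in> {-e<..<e} \<Longrightarrow> (x has_vector_derivative w t) (at t)"
      and dw: "\<And>t. t \<in> {-e<..<e} \<Longrightarrow> (w has_vector_derivative - dom.chris (x t) (w t) (w t)) (at t)"
    have xc: "x t \<in> snd c ` fst c" if "t \<in> {-e<..<e}" for t using xS[OF that] sS by blast
    have G: "geodesic M {-e<..<e} (chart_inv c \<circ> x)"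
      "\<And>t. t \<in> {-e<..<e} \<Longrightarrow> velocity c (chart_inv c \<circ> x) t = w t"
      using M.chart_curve_geodesic[OF c e smx xc dx dw] by blast+
    obtain k where k: "\<And>t c'. t \<in> {-e<..<e} \<Longrightarrow> c' \<in> charts_at M ((chart_inv c \<circ> x) t) \<Longrightarrow>
       exp (f ((chart_inv c \<circ> x) t)) * sin (angle_to (metric_tensor M c' ((chart_inv c \<circ> x) t))
         (horizontal M B F c' ((chart_inv c \<circ> x) t)) (velocity c' (chart_inv c \<circ> x) t)) = k"
      using geo[OF G(1)] by blast
    show "\<exists>k. \<forall>t\<in>{-e<..<e}. (exp ((f \<circ> chart_inv c) (x t)))\<^sup>2 *
        (((lam \<circ> chart_inv c) (x t))\<^sup>2 * local_metric M c (x t) (w t) (w t) - pullback (x t) (w t) (w t))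
         = k * (((lam \<circ> chart_inv c) (x t))\<^sup>2 * local_metric M c (x t) (w t) (w t))"
    proof (intro exI ballI)
      fix t assume t: "t \<in> {-e<..<e}"
      note x = xS[OF t]
      interpret G: inner_form "local_metric M c (x t)" by (rule dom.form[OF x])
      obtain h u where hu: "h \<in> hor (x t)" "u \<in> ver (x t)" "w t = h + u"
        using hor_ver_decomposition[OF x] .
      let ?s = "sin (angle_to (local_metric M c (x t)) (hor (x t)) (w t))"
      let ?l = "(lam \<circ> chart_inv c) (x t)"
      have k': "exp ((f \<circ> chart_inv c) (x t)) * ?s = k"
        using k[OF t, of c] pt[OF x] G(2)[OF t] by simp
      \<comment> \<open>This is the squared length of the vertical part \<open>u\<close>, while
        \<open>pullback\<close> measures the horizontal part \<open>h\<close>; Pythagoras turns the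
        angle relation with constant \<open>k\<close> into the product form with constant
        k^2.\<close>
      have s: "?s\<^sup>2 * local_metric M c (x t) (w t) (w t) = local_metric M c (x t) u u"
        using G.sin_angle_to_ortho_compl[OF subspace_ver[OF x] hu(1,2)] hu(3) by simp
      have "pullback (x t) (w t) (w t) = pullback (x t) h h"
        by (simp add: hu(3) bilinear_radd[OF bilinear_pullback[OF x]] bilinear_ladd[OF bilinear_pullback[OF x]]
            pullback_ver[OF x hu(2)])
      also have "\<dots> = ?l\<^sup>2 * local_metric M c (x t) h h" by (rule pullback_hor[OF x hu(1)])
      finally have P: "pullback (x t) (w t) (w t) = ?l\<^sup>2 * local_metric M c (x t) h h" .
      have "local_metric M c (x t) (w t) (w t) = local_metric M c (x t) h h + local_metric M c (x t) u u"
        using hor_ver_orthogonal[OF x hu(1,2)] by (simp add: hu(3) G.simps)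
      then have "?l\<^sup>2 * local_metric M c (x t) (w t) (w t) - pullback (x t) (w t) (w t)
          = ?l\<^sup>2 * (?s\<^sup>2 * local_metric M c (x t) (w t) (w t))"
        unfolding P s by (simp add: algebra_simps)
      then show "(exp ((f \<circ> chart_inv c) (x t)))\<^sup>2 *
        (?l\<^sup>2 * local_metric M c (x t) (w t) (w t) - pullback (x t) (w t) (w t))
         = k\<^sup>2 * (?l\<^sup>2 * local_metric M c (x t) (w t) (w t))"
        unfolding k'[symmetric] by (simp add: power_mult_distrib)
    qed
  qed
qed

lemma tension_field_eq_0_iff:
  fixes M :: "('m, 'a::euclidean_space) riem_mfd" and B :: "('n, 'b::euclidean_space) riem_mfd"
  assumes M: "riemannian_manifold M" and B: "riemannian_manifold B" and f: "smooth_fun M f"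
    and cl: "clairaut_conformal_submersion M B F lam (\<lambda>p. exp (f p))"
    and c: "c \<in> charts_at M p" and d: "d \<in> charts_at B (F p)"
  shows "tension_field M B F c d p = 0 \<longleftrightarrow>
       (real DIM('a) - real DIM('b)) *\<^sub>R grad M f c p
         = (real DIM('b) - 2) *\<^sub>R grad M (\<lambda>q. ln (lam q)) c p"
proof -
  interpret M: riemannian_manifold M by (rule M)
  interpret B: riemannian_manifold B by (rule B)
  have c': "c \<in> atlas M" "p \<in> fst c" and d': "d \<in> atlas B" "F p \<in> fst d"
    using c d by (auto simp: charts_at_def)
  interpret clairaut_coordinates "snd c ` {p \<in> fst c. F p \<in> fst d}" "local_metric M c"
    "snd d ` fst d" "local_metric B d" "coord_map F c d" "lam \<circ> chart_inv c" "f \<circ> chart_inv c"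
    by (rule clairaut_coordinates_charts[OF M B f cl c'(1) d'(1)])
  let ?x = "snd c p"
  have x: "?x \<in> snd c ` {p \<in> fst c. F p \<in> fst d}" using c' d' by blast
  have inv: "chart_inv c ?x = p" by (rule M.chart_inv_chart[OF c'])
  interpret G: inner_form "metric_tensor M c p" by (rule M.inner_form_metric[OF c])
  have cF: "coord_map F c d ?x = snd d (F p)" using inv by (simp add: coord_map_def)
  have Dp: "differential F c d p = D ?x" unfolding D_def differential_def ..
  have "frechet_derivative ((\<lambda>q. differential F c d q e) \<circ> chart_inv c) (at ?x) u = D2 ?x u e" for e u
    unfolding D2_def
  proof (rule fun_cong[OF frechet_derivative_cong_open[OF dom.open_S x]])
    fix y assume "y \<in> snd c ` {p \<in> fst c. F p \<in> fst d}"
    then show "((\<lambda>q. differential F c d q e) \<circ> chart_inv c) y = D y e"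
      using M.chart_chart_inv[of y c] by (auto simp: differential_def D_def)
  qed
  \<comment> \<open>A field with constant components has zero coordinate derivative, so only the
    Christoffel term of \<open>cov_deriv\<close> survives.\<close>
  then have sff: "second_fundamental_form M B F c d (\<lambda>_. e) (\<lambda>_. e) p = sff ?x e e" for e
    unfolding second_fundamental_form_def pullback_cov_deriv_def cov_deriv_def sff_def
      M.levi_civita_eq_chris[OF c] B.levi_civita_eq_chris[OF d] cF Dp by (simp add: o_def)
  let ?E = "SOME E. orthonormal_basis (metric_tensor M c p) E"
  have E: "G.orthonormal ?E" "span ?E = UNIV"
    using G.orthonormal_basis_some unfolding G.orthonormal_basis_iff by auto
  have "tension_field M B F c d p = (\<Sum>e\<in>?E. sff ?x e e)"
    unfolding tension_field_def sff ..
  then have 1: "tension_field M B F c d p = 0 \<longleftrightarrow>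
     (\<forall>v. (real DIM('a) - real DIM('b)) * df ?x v = (real DIM('b) - 2) * dl ?x v)"
    using tension_eq_0_iff[OF x, unfolded inv, OF E] by simp
  have gf: "metric_tensor M c p (grad M f c p) v = df ?x v" for v
    by (rule M.gradient_inner[OF c smooth_on_differentiable[OF smooth_f x]])
  have dln: "((\<lambda>q. ln (lam q)) \<circ> chart_inv c has_derivative dl ?x) (at ?x)"
  proof -
    have "((\<lambda>y. ln ((lam \<circ> chart_inv c) y)) has_derivative
       (\<lambda>v. frechet_derivative (lam \<circ> chart_inv c) (at ?x) v * inverse ((lam \<circ> chart_inv c) ?x))) (at ?x)"
      using has_derivative_ln[OF l_pos[OF x] smooth_on_has_derivative[OF smooth_l x]] by (simp add: mult.commute)
    moreover have "dl ?x = (\<lambda>v. frechet_derivative (lam \<circ> chart_inv c) (at ?x) v * inverse ((lam \<circ> chart_inv c) ?x))"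
      by (rule ext) (simp only: dl_def divide_inverse)
    moreover have "(\<lambda>q. ln (lam q)) \<circ> chart_inv c = (\<lambda>y. ln ((lam \<circ> chart_inv c) y))"
      by (simp add: o_def)
    ultimately show ?thesis by (simp only:)
  qed
  have gl: "metric_tensor M c p (grad M (\<lambda>q. ln (lam q)) c p) v = dl ?x v" for v
    using M.gradient_inner[OF c, of "\<lambda>q. ln (lam q)"] dln frechet_derivative_at[OF dln]
    by (metis differentiable_def)
  show ?thesis
    unfolding 1
  proof
    assume "\<forall>v. (real DIM('a) - real DIM('b)) * df ?x v = (real DIM('b) - 2) * dl ?x v"
    then show "(real DIM('a) - real DIM('b)) *\<^sub>R grad M f c p = (real DIM('b) - 2) *\<^sub>R grad M (\<lambda>q. ln (lam q)) c p"
      by (intro G.nondegenerate) (simp add: G.simps gf gl)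
  next
    assume *: "(real DIM('a) - real DIM('b)) *\<^sub>R grad M f c p = (real DIM('b) - 2) *\<^sub>R grad M (\<lambda>q. ln (lam q)) c p"
    show "\<forall>v. (real DIM('a) - real DIM('b)) * df ?x v = (real DIM('b) - 2) * dl ?x v"
    proof
      fix v
      show "(real DIM('a) - real DIM('b)) * df ?x v = (real DIM('b) - 2) * dl ?x v"
        using arg_cong[OF *, of "\<lambda>w. metric_tensor M c p w v"] by (simp add: G.simps gf gl)
    qed
  qed
qed

theorem theorem17:
  fixes M :: "('m, 'a::euclidean_space) riem_mfd"
    and B :: "('n, 'b::euclidean_space) riem_mfd"
    and F :: "'m \<Rightarrow> 'n"
    and f lam :: "'m \<Rightarrow> real"
  assumes "riemannian_manifold M"
    and "riemannian_manifold B"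
    and "smooth_fun M f"
    and "clairaut_conformal_submersion M B F lam (\<lambda>p. exp (f p))"
  shows "harmonic_map M B F \<longleftrightarrow>
    (\<forall>p\<in>points M. \<forall>c\<in>charts_at M p.
       (real DIM('a) - real DIM('b)) *\<^sub>R grad M f c p
         = (real DIM('b) - 2) *\<^sub>R grad M (\<lambda>q. ln (lam q)) c p)"
proof -
  have "continuous_map (mtop M) (mtop B) F"
    using assms(4) unfolding clairaut_conformal_submersion_def conformal_submersion_def
      submersion_def smooth_map_def by blast
  then have "F p \<in> points B" if "p \<in> points M" for p
    using that continuous_map_image_subset_topspace by fastforce
  \<comment> \<open>The gradient equation mentions no chart of \<open>B\<close>, so deducing it from
    harmonicity needs at least one chart around \<open>F p\<close>.\<close>
  then have "charts_at B (F p) \<noteq> {}" if "p \<in> points M" for p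
    using that riemannian_manifold.cover[OF assms(2)] unfolding charts_at_def by fastforce
  then show ?thesis
    unfolding harmonic_map_def using tension_field_eq_0_iff[OF assms] by blast
qed

end
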